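(* Let $\{X_k\}_{k\ge 0}$ be the Markov chain on $\mathbb{R}^2$ given by the Metropolis–Hastings algorithm (described in the context) with proposals uniform on the annulus $B_x=\{z\in\mathbb{R}^2:|\,\|x\|-1|<\|z\|<\|x\|+1\}$, for the unnormalized density $\pi(x)=e^{-H(x)}$, $H(x)=\|x\|+\frac1{\|x\|}$, started from $X_0=(1,0)$. Then for every $n\in\mathbb{N}$, $$\bigg\|\frac1n\sum_{k=1}^n\mathbf{P}(X_k\in\cdot)-\pi(\cdot)\bigg\|\ \le\ \frac{39{,}900{,}000}{n}.$$
   Context: $\|x\|$ is the Euclidean norm on $\mathbb{R}^2$ and $r_x=\|x\|$; for probability measures, $\|\mu-\nu\|=\sup_S|\mu(S)-\nu(S)|$ (supremum over measurable $S$) is total variation distance. In the displayed bound, $\pi(\cdot)$ is the probability measure on $\mathbb{R}^2$ with Lebesgue density proportional to $e^{-H(x)}$. The algorithm: from $x\ne0$, a proposal $y$ is drawn from the uniform distribution on $B_x$, which has area $4\pi r_x$ (here $\pi$ is the number $3.14\ldots$), i.e. with density $q(x,y)=\mathbf{1}_{B_x}(y)/(4\pi r_x)$. With probability $$\alpha(x,y)=\min\Big\{1,\frac{\pi(y)q(y,x)}{\pi(x)q(x,y)}\Big\}=\min\Big\{1,\frac{e^{H(x)}r_x}{e^{H(y)}r_y}\Big\}$$ the chain moves to $y$; otherwise it stays at $x$. The single point $x=0$ is a null set where $H(0)=+\infty$; the kernel there may be defined arbitrarily. *)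

theory Defs
  imports "HOL-Probability.Probability"
begin

section \<open>Total variation distance\<close>

text \<open>Probability laws are given as set functions \<open>S \<mapsto> \<mu>(S)\<close>, so that averages of laws need no
  measure construction of their own. The supremum is over a bounded set whenever both arguments
  are probability laws.\<close>

definition tv_dist :: "'a measure \<Rightarrow> ('a set \<Rightarrow> real) \<Rightarrow> ('a set \<Rightarrow> real) \<Rightarrow> real" where
  "tv_dist N \<mu> \<nu> = (SUP S\<in>sets N. \<bar>\<mu> S - \<nu> S\<bar>)"


section \<open>Markov chains with a given transition kernel\<close>

definition history :: "'w measure \<Rightarrow> 'a measure \<Rightarrow> (nat \<Rightarrow> 'w \<Rightarrow> 'a) \<Rightarrow> nat \<Rightarrow> 'w measure" where
  "history M N X k = sigma (space M) {X i -` A \<inter> space M |i A. i \<le> k \<and> A \<in> sets N}"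

text \<open>The Markov property is stated with respect to the natural filtration:
  \<open>P(X\<^sub>k\<^sub>+\<^sub>1 \<in> A | X\<^sub>0, \<dots>, X\<^sub>k) = K(X\<^sub>k, A)\<close> almost surely.\<close>

definition markov_chain ::
    "'w measure \<Rightarrow> 'a measure \<Rightarrow> ('a \<Rightarrow> 'a measure) \<Rightarrow> 'a \<Rightarrow> (nat \<Rightarrow> 'w \<Rightarrow> 'a) \<Rightarrow> bool" where
  "markov_chain M N K x0 X \<longleftrightarrow>
     prob_space M \<and>
     (\<forall>k. X k \<in> measurable M N) \<and>
     (AE \<omega> in M. X 0 \<omega> = x0) \<and>
     (\<forall>k. \<forall>A\<in>sets N. AE \<omega> in M.
        real_cond_exp M (history M N X k) (\<lambda>\<omega>'. indicator A (X (Suc k) \<omega>')) \<omega>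
          = measure (K (X k \<omega>)) A)"


section \<open>The Metropolis--Hastings kernel\<close>

text \<open>Here \<open>p\<close> is an unnormalized target density and \<open>q x\<close> is the proposal density from \<open>x\<close>, both
  with respect to Lebesgue measure. Where the denominator \<open>p x * q x y\<close> vanishes the acceptance
  probability is \<open>0\<close>; for \<open>p x > 0\<close> such \<open>y\<close> are proposed with probability \<open>0\<close>.\<close>

definition mh_accept :: "('a \<Rightarrow> real) \<Rightarrow> ('a \<Rightarrow> 'a \<Rightarrow> real) \<Rightarrow> 'a \<Rightarrow> 'a \<Rightarrow> real" where
  "mh_accept p q x y = min 1 ((p y * q y x) / (p x * q x y))"

definition mh_kernel ::
    "('a::euclidean_space \<Rightarrow> real) \<Rightarrow> ('a \<Rightarrow> 'a \<Rightarrow> real) \<Rightarrow> 'a \<Rightarrow> 'a measure" where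
  "mh_kernel p q x =
     density lborel (\<lambda>y. ennreal (q x y)) \<bind> (\<lambda>y.
     measure_pmf (bernoulli_pmf (mh_accept p q x y)) \<bind> (\<lambda>accepted.
     return borel (if accepted then y else x)))"


section \<open>The annulus chain\<close>

definition annulus :: "real^2 \<Rightarrow> (real^2) set" where
  "annulus x = {z. \<bar>norm x - 1\<bar> < norm z \<and> norm z < norm x + 1}"

definition proposal_density :: "real^2 \<Rightarrow> real^2 \<Rightarrow> real" where
  "proposal_density x y = indicator (annulus x) y / (4 * pi * norm x)"

lemma emeasure_annulus:
  assumes "x \<noteq> 0"
  shows "emeasure lborel (annulus x) = ennreal (4 * pi * norm x)"
proof -
  have eq: "annulus x = ball 0 (norm x + 1) - cball 0 \<bar>norm x - 1\<bar>"
    by (auto simp: annulus_def)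
  have sub: "cball 0 \<bar>norm x - 1\<bar> \<subseteq> (ball 0 (norm x + 1) :: (real^2) set)"
    using assms by (auto simp: abs_if split: if_splits) (smt (verit) norm_ge_zero zero_less_norm_iff)+
  show ?thesis
    unfolding eq using sub
    apply (subst emeasure_Diff)
    apply (auto simp: emeasure_ball emeasure_cball unit_ball_vol_2 ennreal_minus)
    apply (simp add: algebra_simps power2_eq_square)
    done
qed

lemma proposal_uniform:
  assumes "x \<noteq> 0"
  shows "density lborel (\<lambda>y. ennreal (proposal_density x y)) = uniform_measure lborel (annulus x)"
proof -
  have "ennreal (proposal_density x y) = indicator (annulus x) y / emeasure lborel (annulus x)" for y
    using assms by (auto simp: proposal_density_def emeasure_annulus indicator_def divide_ennreal simp flip: ennreal_1)
  then show ?thesis by (simp add: uniform_measure_def)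
qed

text \<open>The case \<open>x = 0\<close> encodes \<open>H(0) = +\<infinity>\<close>.\<close>

definition target_density :: "real^2 \<Rightarrow> real" where
  "target_density x = (if x = 0 then 0 else exp (- (norm x + 1 / norm x)))"

definition target_measure :: "(real^2) measure" where
  "target_measure =
     density lborel (\<lambda>x. ennreal (target_density x / (\<integral>z. target_density z \<partial>lborel)))"

text \<open>At the origin, where the annulus is empty, the chain is made to stay put.\<close>

definition annulus_kernel :: "real^2 \<Rightarrow> (real^2) measure" where
  "annulus_kernel x =
     (if x = 0 then return borel 0 else mh_kernel target_density proposal_density x)"

end

theory Submission
  imports Defs
begin

text \<open>
  The chain satisfies a drift condition \<open>K V \<le> \<lambda> V + b 1\<^sub>C\<close> towards an annulus \<open>C\<close> on which its
  kernel \<open>K\<close> dominates one fixed nonzero measure \<open>\<nu>\<close>. These two facts bound the averages through an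
  almost explicit solution of Poisson's equation. Put \<open>R = K - 1\<^sub>C \<otimes> \<nu>\<close>, a substochastic kernel, and
  \<open>u\<^sub>S = (\<Sum>k. R^k 1\<^sub>S)\<close>; by the drift condition, \<open>u\<^sub>S\<close> is at most a multiple of \<open>V\<close> plus a constant
  (\<open>potential_le_bound\<close>). Since \<open>u\<^sub>S = 1\<^sub>S + R u\<^sub>S\<close>, one has \<open>K u\<^sub>S + 1\<^sub>S = u\<^sub>S + \<nu>(u\<^sub>S) 1\<^sub>C\<close>.
  Integrated against the invariant law \<open>\<pi>\<close>, this identity gives \<open>\<pi>(S) = \<pi>(C) \<nu>(u\<^sub>S)\<close>. Integrated
  against the laws of \<open>X\<^sub>1, \<dots>, X\<^sub>n\<close> and summed, it telescopes (\<open>balance\<close>): up to boundary terms at times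
  \<open>1\<close> and \<open>n + 1\<close>, the expected number of visits to \<open>S\<close> is \<open>\<nu>(u\<^sub>S)\<close> times that to \<open>C\<close>. Comparing \<open>S\<close>
  with the whole space removes the visits to \<open>C\<close> and leaves \<open>n \<pi>(S)\<close> plus boundary terms, which are
  bounded because the drift keeps the expectation of \<open>V\<close> bounded in time (\<open>averages_bound\<close>).

  For the annulus chain acceptance and weight depend on the radius \<open>r\<close> only, and \<open>V\<close> is \<open>exp (r/16)\<close> for
  \<open>r \<ge> 1/2\<close>. Beyond \<open>r = 12/5\<close> every inward proposal is accepted, while an outward proposal by \<open>u\<close>
  survives with probability about \<open>exp (-u)\<close>, which outweighs the greater area of the outer part of
  the annulus (\<open>weight_drift_far\<close>). For \<open>r < 1/2\<close> the density is so small that at least a third of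
  the proposals is accepted, and all of them land in \<open>C\<close>, that is, in \<open>1/2 \<le> r \<le> 12/5\<close>
  (\<open>weight_drift_small\<close>). From every point of \<open>C\<close> the thin annulus \<open>7/5 < r < 3/2\<close> lies within reach
  (\<open>minorant_le_kernel\<close>). The constants are \<open>\<lambda> = 1999/2000\<close>, \<open>b = 1/2\<close> and \<open>\<nu>\<close> of mass \<open>29/1000\<close>; they
  give a bound near \<open>4.1 * 10^6\<close>, well below the required one.
\<close>


section \<open>Averages of a Markov chain under drift and minorization\<close>

lemma nn_integral_add_measure:
  assumes sets: "sets \<kappa> = sets N" "sets \<rho> = sets N" "sets \<nu> = sets N"
    and split: "\<And>A. A \<in> sets N \<Longrightarrow> emeasure \<kappa> A = emeasure \<rho> A + emeasure \<nu> A"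
    and f: "f \<in> borel_measurable N"
  shows "(\<integral>\<^sup>+x. f x \<partial>\<kappa>) = (\<integral>\<^sup>+x. f x \<partial>\<rho>) + (\<integral>\<^sup>+x. f x \<partial>\<nu>)"
  using f
proof (induct rule: borel_measurable_induct)
  note [measurable_cong] = sets and space = sets[THEN sets_eq_imp_space_eq]
  {
    case (cong f g)
    have "integral\<^sup>N \<mu> f = integral\<^sup>N \<mu> g" if "space \<mu> = space N" for \<mu>
      using cong(3) that by (intro nn_integral_cong) simp
    then show ?case using cong(4) space by simp
  next
    case (set A)
    then show ?case using sets by (simp add: split)
  next
    case (mult f c)
    then show ?case by (simp add: nn_integral_cmult distrib_left)
  next
    case (add u v)
    then show ?case by (simp add: nn_integral_add ac_simps)
  next
    case (seq U)
    have mono: "incseq (\<lambda>i. integral\<^sup>N \<mu> (U i))" for \<mu>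
      using seq(4) by (auto simp: mono_def le_fun_def intro!: nn_integral_mono)
    have sup: "integral\<^sup>N \<mu> (Sup (range U)) = (SUP i. integral\<^sup>N \<mu> (U i))"
      if [measurable_cong]: "sets \<mu> = sets N" for \<mu>
      using seq(1,4) nn_integral_monotone_convergence_SUP[of U \<mu>] by (simp add: SUP_apply[abs_def] image_comp)
    show ?case
      unfolding sup[OF sets(1)] sup[OF sets(2)] sup[OF sets(3)] seq(3)
      by (rule ennreal_SUP_add[OF mono mono])
  }
qed

text \<open>The weight \<open>V\<close> may be infinite, which accommodates a null set of states, such as the origin below,
  where no drift towards \<open>C\<close> holds. The measure \<open>\<nu>\<close> is not normalized: its mass plays the part of the
  usual minorization constant.\<close>
locale drift_minorization =
  fixes N :: "'a measure" and K :: "'a \<Rightarrow> 'a measure" and C :: "'a set" and \<nu> :: "'a measure"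
    and V :: "'a \<Rightarrow> ennreal" and lam b \<epsilon> :: real
  assumes kernel: "K \<in> N \<rightarrow>\<^sub>M prob_algebra N"
    and C: "C \<in> sets N"
    and sets_\<nu>: "sets \<nu> = sets N"
    and fin_\<nu>: "finite_measure \<nu>"
    and minor: "\<And>x A. x \<in> C \<Longrightarrow> A \<in> sets N \<Longrightarrow> emeasure \<nu> A \<le> emeasure (K x) A"
    and \<epsilon>: "\<epsilon> > 0" "ennreal \<epsilon> \<le> emeasure \<nu> (space N)"
    and V: "V \<in> borel_measurable N"
    and V_ge_1: "\<And>x. x \<in> space N \<Longrightarrow> 1 \<le> V x"
    and lam: "0 \<le> lam" "lam < 1" and b: "0 \<le> b"
    and drift: "\<And>x. x \<in> space N \<Longrightarrow> (\<integral>\<^sup>+y. V y \<partial>K x) \<le> ennreal lam * V x + ennreal b * indicator C x"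
begin

declare C[measurable] V[measurable] sets_\<nu>[measurable_cong]

lemma kernel_sub[measurable]: "K \<in> N \<rightarrow>\<^sub>M subprob_algebra N"
  using kernel by (rule measurable_prob_algebraD)

lemma kernel_prob: "x \<in> space N \<Longrightarrow> prob_space (K x)"
  using measurable_space[OF kernel] by (auto simp: space_prob_algebra)

lemma kernel_sets: "x \<in> space N \<Longrightarrow> sets (K x) = sets N"
  using measurable_space[OF kernel] by (auto simp: space_prob_algebra)

text \<open>The kernel \<open>K - 1\<^sub>C \<otimes> \<nu>\<close>: the chain killed at its regeneration times. Making it a kernel
  in its own right confines all later arguments to nonnegative functions, with no subtraction of
  infinite integrals.\<close>
definition residual :: "'a \<Rightarrow> 'a measure" where
  "residual x = (if x \<in> C then diff_measure (K x) \<nu> else K x)"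

lemma sets_residual: "x \<in> space N \<Longrightarrow> sets (residual x) = sets N"
  by (simp add: residual_def kernel_sets)

lemma emeasure_residual:
  assumes x: "x \<in> space N" and A: "A \<in> sets N"
  shows "emeasure (residual x) A = emeasure (K x) A - indicator C x * emeasure \<nu> A"
  using assms kernel_sets[OF x] kernel_prob[OF x] minor
  by (auto simp: residual_def sets_\<nu> fin_\<nu> prob_space_def intro!: emeasure_diff_measure)

lemma residual_kernel[measurable]: "residual \<in> N \<rightarrow>\<^sub>M subprob_algebra N"
proof (rule measurable_subprob_algebra)
  fix x assume x: "x \<in> space N"
  show "subprob_space (residual x)"
  proof
    have sp: "space (residual x) = space N" "space (K x) = space N"
      using sets_residual[OF x] kernel_sets[OF x] by (auto dest: sets_eq_imp_space_eq)
    have "emeasure (residual x) (space N) \<le> emeasure (K x) (space N)"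
      by (simp add: emeasure_residual[OF x] diff_le_self_ennreal)
    also have "\<dots> = 1"
      using prob_space.emeasure_space_1[OF kernel_prob[OF x]] sp by simp
    finally show "emeasure (residual x) (space (residual x)) \<le> 1" by (simp add: sp)
    show "space (residual x) \<noteq> {}" using x sp by auto
  qed
next
  fix A assume A[measurable]: "A \<in> sets N"
  have "(\<lambda>x. emeasure (K x) A - indicator C x * emeasure \<nu> A) \<in> borel_measurable N"
    by measurable
  then show "(\<lambda>x. emeasure (residual x) A) \<in> borel_measurable N"
    by (rule measurable_cong[THEN iffD1, rotated]) (simp add: emeasure_residual A)
qed (simp add: sets_residual)

lemma kernel_split:
  assumes x: "x \<in> space N" and f[measurable]: "f \<in> borel_measurable N"
  shows "(\<integral>\<^sup>+y. f y \<partial>K x) = (\<integral>\<^sup>+y. f y \<partial>residual x) + indicator C x * (\<integral>\<^sup>+y. f y \<partial>\<nu>)"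
proof (cases "x \<in> C")
  case True
  have "emeasure (K x) A = emeasure (residual x) A + emeasure \<nu> A" if A: "A \<in> sets N" for A
    using True minor[OF True A] by (simp add: emeasure_residual[OF x A] diff_add_cancel_ennreal)
  from nn_integral_add_measure[OF kernel_sets[OF x] sets_residual[OF x] sets_\<nu> this f]
  show ?thesis using True by simp
qed (simp add: residual_def)

text \<open>Expected number of visits to \<open>S\<close> before time \<open>m\<close> and before killing.\<close>
primrec occupation :: "'a set \<Rightarrow> nat \<Rightarrow> 'a \<Rightarrow> ennreal" where
  "occupation S 0 x = 0"
| "occupation S (Suc m) x = indicator S x + (\<integral>\<^sup>+y. occupation S m y \<partial>residual x)"

lemma occupation_measurable[measurable]:
  assumes [measurable]: "S \<in> sets N"
  shows "occupation S m \<in> borel_measurable N"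
proof (induction m)
  case (Suc m)
  note [measurable] = Suc
  have "(\<lambda>x. \<integral>\<^sup>+y. occupation S m y \<partial>residual x) \<in> borel_measurable N"
    using measurable_compose[OF residual_kernel nn_integral_measurable_subprob_algebra[OF Suc]] .
  then have "(\<lambda>x. indicator S x + (\<integral>\<^sup>+y. occupation S m y \<partial>residual x)) \<in> borel_measurable N"
    by measurable
  then show ?case by simp
qed (simp add: fun_eq_iff[symmetric] measurable_const[of 0 borel N] cong: measurable_cong)

lemma occupation_mono: "occupation S m x \<le> occupation S (Suc m) x"
proof (induction m arbitrary: x)
  case (Suc m)
  then show ?case by (auto intro!: add_left_mono nn_integral_mono)
qed simp

definition potential :: "'a set \<Rightarrow> 'a \<Rightarrow> ennreal" where
  "potential S x = (SUP m. occupation S m x)"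

lemma potential_measurable[measurable]: "S \<in> sets N \<Longrightarrow> potential S \<in> borel_measurable N"
  unfolding potential_def[abs_def] by measurable

lemma potential_fixpoint:
  assumes x: "x \<in> space N" and S[measurable]: "S \<in> sets N"
  shows "potential S x = indicator S x + (\<integral>\<^sup>+y. potential S y \<partial>residual x)"
proof -
  note [measurable_cong] = sets_residual[OF x]
  have inc: "incseq (occupation S)"
    by (intro incseq_SucI le_funI occupation_mono)
  have "potential S x = (SUP m. occupation S (Suc m) x)"
    unfolding potential_def
  proof (rule antisym; rule SUP_mono)
    show "\<exists>j\<in>UNIV. occupation S m x \<le> occupation S (Suc j) x" for m
      using occupation_mono by blast
    show "\<exists>j\<in>UNIV. occupation S (Suc m) x \<le> occupation S j x" for m
      by blast
  qed
  also have "\<dots> = indicator S x + (SUP m. \<integral>\<^sup>+y. occupation S m y \<partial>residual x)"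
    by (simp add: ennreal_SUP_add_right)
  also have "(SUP m. \<integral>\<^sup>+y. occupation S m y \<partial>residual x) = (\<integral>\<^sup>+y. potential S y \<partial>residual x)"
    unfolding potential_def by (intro nn_integral_monotone_convergence_SUP[symmetric] inc) measurable
  finally show ?thesis .
qed

text \<open>The constant \<open>b / \<epsilon>\<close> pays for the failure of the drift on \<open>C\<close>: there the drift condition may lose \<open>b\<close>,
  but a constant function loses at least the fraction \<open>\<epsilon>\<close> of its value to killing.\<close>
definition potential_bound :: "'a \<Rightarrow> ennreal" where
  "potential_bound x = ennreal (1 / (1 - lam)) * (V x + ennreal (b / \<epsilon>))"

lemma potential_bound_measurable[measurable]: "potential_bound \<in> borel_measurable N"
  unfolding potential_bound_def[abs_def] by measurable

lemma potential_bound_supersolution: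
  assumes x: "x \<in> space N"
  shows "1 + (\<integral>\<^sup>+y. potential_bound y \<partial>residual x) \<le> potential_bound x"
proof (cases "V x")
  case top
  then show ?thesis using lam by (simp add: potential_bound_def ennreal_mult_top)
next
  case (real v)
  note [measurable_cong] = sets_residual[OF x]
  have v1: "1 \<le> v" using V_ge_1[OF x] real by simp
  define i :: real where "i = indicator C x"
  have i01: "0 \<le> i" "i \<le> 1" by (auto simp: i_def)
  have sp: "space (residual x) = space N" "space (K x) = space N"
    using sets_residual[OF x] kernel_sets[OF x] by (auto dest: sets_eq_imp_space_eq)
  have K1: "emeasure (K x) (space N) = 1"
    using prob_space.emeasure_space_1[OF kernel_prob[OF x]] sp by simp
  have "(\<integral>\<^sup>+y. V y \<partial>residual x) \<le> (\<integral>\<^sup>+y. V y \<partial>K x)"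
    by (subst kernel_split[OF x]) auto
  also have "\<dots> \<le> ennreal (lam * v + b * i)"
    using drift[OF x] real lam b v1
    by (auto simp: i_def ennreal_mult ennreal_plus indicator_def)
  finally have RV: "(\<integral>\<^sup>+y. V y \<partial>residual x) \<le> ennreal (lam * v + b * i)" .
  have \<epsilon>1: "\<epsilon> * i \<le> 1"
  proof (cases "x \<in> C")
    case True
    have "ennreal \<epsilon> \<le> 1"
      using minor[OF True sets.top] \<epsilon>(2) K1 by (metis order_trans)
    then show ?thesis using True \<epsilon>(1) by (simp add: i_def)
  qed (simp add: i_def)
  have R1: "emeasure (residual x) (space N) \<le> ennreal (1 - \<epsilon> * i)"
  proof (cases "x \<in> C")
    case True
    have "emeasure (residual x) (space N) = 1 - emeasure \<nu> (space N)"
      using True K1 by (simp add: emeasure_residual[OF x])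
    also have "\<dots> \<le> 1 - ennreal \<epsilon>" using \<epsilon> by (intro ennreal_minus_mono) auto
    also have "\<dots> = ennreal (1 - \<epsilon>)" using \<epsilon>(1) by (simp add: ennreal_minus flip: ennreal_1)
    finally show ?thesis using True by (simp add: i_def)
  qed (simp add: i_def emeasure_residual[OF x] K1)
  have "(\<integral>\<^sup>+y. potential_bound y \<partial>residual x) = ennreal (1 / (1 - lam)) *
      ((\<integral>\<^sup>+y. V y \<partial>residual x) + ennreal (b / \<epsilon>) * emeasure (residual x) (space N))"
    unfolding potential_bound_def by (subst nn_integral_cmult) (auto simp: nn_integral_add sp)
  also have "\<dots> \<le> ennreal (1 / (1 - lam)) * (ennreal (lam * v + b * i) + ennreal (b / \<epsilon>) * ennreal (1 - \<epsilon> * i))"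
    using RV R1 by (intro mult_left_mono add_mono) auto
  also have "\<dots> = ennreal ((lam * v + b * i + b / \<epsilon> * (1 - \<epsilon> * i)) / (1 - lam))"
    using lam b v1 i01 \<epsilon> \<epsilon>1
    by (simp add: ennreal_mult[symmetric] ennreal_plus[symmetric] del: ennreal_plus)
  also have "(lam * v + b * i + b / \<epsilon> * (1 - \<epsilon> * i)) / (1 - lam) = (lam * v + b / \<epsilon>) / (1 - lam)"
    using \<epsilon> by (simp add: field_simps)
  finally have "1 + (\<integral>\<^sup>+y. potential_bound y \<partial>residual x) \<le> 1 + ennreal ((lam * v + b / \<epsilon>) / (1 - lam))"
    by (rule add_left_mono)
  also have "\<dots> = ennreal (1 + (lam * v + b / \<epsilon>) / (1 - lam))"
    using lam b v1 \<epsilon> by (subst ennreal_plus) auto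
  also have "\<dots> \<le> ennreal ((v + b / \<epsilon>) / (1 - lam))"
  proof (rule ennreal_leI)
    have "1 - lam \<le> (1 - lam) * v" using lam v1 by simp
    then have "1 - lam + (lam * v + b / \<epsilon>) \<le> v + b / \<epsilon>" by (simp add: algebra_simps)
    then show "1 + (lam * v + b / \<epsilon>) / (1 - lam) \<le> (v + b / \<epsilon>) / (1 - lam)"
      using lam divide_right_mono[of "1 - lam + (lam * v + b / \<epsilon>)" "v + b / \<epsilon>" "1 - lam"]
      by (simp add: add_divide_distrib)
  qed
  also have "\<dots> = potential_bound x"
    using real lam b \<epsilon> v1
    by (simp add: potential_bound_def ennreal_mult[symmetric] ennreal_plus[symmetric] del: ennreal_plus)
  finally show ?thesis .
qed

text \<open>A nonnegative \<open>W\<close> with \<open>1 + R W \<le> W\<close> dominates all partial sums of \<open>(\<Sum>k. R^k 1\<^sub>S)\<close>, by induction.\<close>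
lemma potential_le_bound:
  assumes x: "x \<in> space N"
  shows "potential S x \<le> potential_bound x"
proof -
  have "occupation S m x \<le> potential_bound x" for m
    using x
  proof (induction m arbitrary: x)
    case (Suc m)
    have "space (residual x) = space N"
      using sets_residual[OF Suc.prems] by (auto dest: sets_eq_imp_space_eq)
    then have "(\<integral>\<^sup>+y. occupation S m y \<partial>residual x) \<le> (\<integral>\<^sup>+y. potential_bound y \<partial>residual x)"
      using Suc.IH by (intro nn_integral_mono) auto
    then have "occupation S (Suc m) x \<le> 1 + (\<integral>\<^sup>+y. potential_bound y \<partial>residual x)"
      by (simp only: occupation.simps) (intro add_mono, auto simp: indicator_def)
    also have "\<dots> \<le> potential_bound x" by (rule potential_bound_supersolution[OF Suc.prems])
    finally show ?case .
  qed simp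
  then show ?thesis unfolding potential_def by (rule SUP_least)
qed

text \<open>Poisson's equation for the potential, integrated: over one step the expected potential drops by the
  probability of \<open>S\<close> and gains a multiple of the probability of \<open>C\<close>, and the factor does not depend
  on the law.\<close>
lemma balance:
  assumes sets_\<mu>[measurable_cong]: "sets \<mu> = sets N" and S[measurable]: "S \<in> sets N"
  shows "(\<integral>\<^sup>+x. potential S x \<partial>(\<mu> \<bind> K)) + emeasure \<mu> S
       = (\<integral>\<^sup>+x. potential S x \<partial>\<mu>) + emeasure \<mu> C * (\<integral>\<^sup>+y. potential S y \<partial>\<nu>)"
proof -
  have sp: "space \<mu> = space N" using sets_\<mu> by (rule sets_eq_imp_space_eq)
  have [measurable]: "(\<lambda>x. \<integral>\<^sup>+y. potential S y \<partial>K x) \<in> borel_measurable N"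
    using measurable_compose[OF kernel_sub nn_integral_measurable_subprob_algebra[OF potential_measurable[OF S]]] .
  have "(\<integral>\<^sup>+x. potential S x \<partial>(\<mu> \<bind> K)) + emeasure \<mu> S
      = (\<integral>\<^sup>+x. (\<integral>\<^sup>+y. potential S y \<partial>K x) + indicator S x \<partial>\<mu>)"
    using sets_\<mu> by (subst nn_integral_bind[where B = N]) (auto simp: nn_integral_add)
  also have "\<dots> = (\<integral>\<^sup>+x. potential S x + indicator C x * (\<integral>\<^sup>+y. potential S y \<partial>\<nu>) \<partial>\<mu>)"
    by (intro nn_integral_cong)
      (simp add: sp potential_fixpoint[OF _ S] kernel_split potential_measurable[OF S] ac_simps)
  also have "\<dots> = (\<integral>\<^sup>+x. potential S x \<partial>\<mu>) + emeasure \<mu> C * (\<integral>\<^sup>+y. potential S y \<partial>\<nu>)"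
    using sets_\<mu> by (subst nn_integral_add) (auto simp: nn_integral_multc)
  finally show ?thesis .
qed

lemma drift_bound:
  assumes \<mu>: "\<And>k. sets (\<mu> k) = sets N" "\<And>k. prob_space (\<mu> k)" "\<And>k. \<mu> (Suc k) = \<mu> k \<bind> K"
    and v: "0 \<le> v" "(\<integral>\<^sup>+x. V x \<partial>\<mu> 0) \<le> ennreal v"
  shows "(\<integral>\<^sup>+x. V x \<partial>\<mu> k) \<le> ennreal (v + b / (1 - lam))"
proof (induction k)
  case 0
  have "v \<le> v + b / (1 - lam)" using lam b by simp
  then show ?case using v(2) by (meson ennreal_leI order_trans)
next
  case (Suc k)
  note [measurable_cong] = \<mu>(1)[of k]
  interpret prob_space "\<mu> k" by fact
  have sp: "space (\<mu> k) = space N" using \<mu>(1) by (rule sets_eq_imp_space_eq)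
  have pos: "0 \<le> b / (1 - lam)" using lam b by simp
  have "(\<integral>\<^sup>+x. V x \<partial>\<mu> (Suc k)) = (\<integral>\<^sup>+x. \<integral>\<^sup>+y. V y \<partial>K x \<partial>\<mu> k)"
    unfolding \<mu>(3) by (subst nn_integral_bind[where B = N]) auto
  also have "\<dots> \<le> (\<integral>\<^sup>+x. ennreal lam * V x + ennreal b \<partial>\<mu> k)"
  proof (intro nn_integral_mono)
    fix x assume "x \<in> space (\<mu> k)"
    then show "(\<integral>\<^sup>+y. V y \<partial>K x) \<le> ennreal lam * V x + ennreal b"
      using drift[of x] by (auto simp: sp indicator_def split: if_splits intro: order_trans)
  qed
  also have "\<dots> = ennreal lam * (\<integral>\<^sup>+x. V x \<partial>\<mu> k) + ennreal b"
    by (subst nn_integral_add) (auto simp: nn_integral_cmult emeasure_space_1)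
  also have "\<dots> \<le> ennreal lam * ennreal (v + b / (1 - lam)) + ennreal b"
    by (intro add_mono mult_left_mono Suc) auto
  also have "\<dots> = ennreal (lam * (v + b / (1 - lam)) + b)"
    using lam b v pos by (simp add: ennreal_mult[symmetric] ennreal_plus[symmetric] del: ennreal_plus)
  also have "lam * (v + b / (1 - lam)) + b = lam * v + b / (1 - lam)"
    using lam by (simp add: field_simps)
  also have "\<dots> \<le> v + b / (1 - lam)"
    using lam v mult_right_mono[of lam 1 v] by simp
  finally show ?case by (simp add: ennreal_leI)
qed

text \<open>Summing \<open>balance\<close> over time for \<open>S\<close> and for the whole space, and using it for \<open>\<pi>\<close> to identify the
  ratio of the two factors as \<open>\<pi>(S)\<close>, eliminates the visits to \<open>C\<close>. Only the potentials at times \<open>1\<close>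
  and \<open>n + 1\<close> remain, whence a bound independent of \<open>n\<close>.\<close>
theorem averages_bound:
  assumes \<mu>: "\<And>k. sets (\<mu> k) = sets N" "\<And>k. prob_space (\<mu> k)" "\<And>k. \<mu> (Suc k) = \<mu> k \<bind> K"
    and v: "0 \<le> v" "(\<integral>\<^sup>+x. V x \<partial>\<mu> 0) \<le> ennreal v"
    and \<pi>: "sets \<pi> = sets N" "prob_space \<pi>" "\<pi> \<bind> K = \<pi>" "(\<integral>\<^sup>+x. V x \<partial>\<pi>) < \<infinity>"
    and S: "S \<in> sets N"
  shows "\<bar>(\<Sum>k=1..n. measure (\<mu> k) S) - real n * measure \<pi> S\<bar>
      \<le> 2 * (v + b / (1 - lam) + b / \<epsilon>) / (1 - lam)"
proof -
  define B where "B = (v + b / (1 - lam) + b / \<epsilon>) / (1 - lam)"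
  define a where "a S k = enn2real (\<integral>\<^sup>+x. potential S x \<partial>\<mu> k)" for S k
  define g where "g S = enn2real (\<integral>\<^sup>+x. potential S x \<partial>\<nu>)" for S
  have pos: "0 \<le> b / (1 - lam)" "0 \<le> b / \<epsilon>" "0 < 1 / (1 - lam)" using lam b \<epsilon> by auto
  have a0: "0 \<le> a S k" and g0: "0 \<le> g S" for S k
    by (simp_all add: a_def g_def)
  have B0: "0 \<le> B" using pos v lam unfolding B_def by (intro divide_nonneg_pos) auto
  interpret P: prob_space \<pi> by fact

  have bnd: "(\<integral>\<^sup>+x. potential S x \<partial>\<kappa>) \<le> ennreal (1 / (1 - lam)) * ((\<integral>\<^sup>+x. V x \<partial>\<kappa>) + ennreal (b / \<epsilon>))"
    if [measurable_cong]: "sets \<kappa> = sets N" and "prob_space \<kappa>" for \<kappa> S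
  proof -
    interpret prob_space \<kappa> by fact
    have "space \<kappa> = space N" using that(1) by (rule sets_eq_imp_space_eq)
    then have "(\<integral>\<^sup>+x. potential S x \<partial>\<kappa>) \<le> (\<integral>\<^sup>+x. potential_bound x \<partial>\<kappa>)"
      by (intro nn_integral_mono potential_le_bound) simp
    also have "\<dots> = ennreal (1 / (1 - lam)) * ((\<integral>\<^sup>+x. V x \<partial>\<kappa>) + ennreal (b / \<epsilon>))"
      unfolding potential_bound_def by (subst nn_integral_cmult) (auto simp: nn_integral_add emeasure_space_1)
    finally show ?thesis .
  qed
  have \<mu>_bnd: "(\<integral>\<^sup>+x. potential T x \<partial>\<mu> k) \<le> ennreal B" for T k
  proof -
    have "(\<integral>\<^sup>+x. potential T x \<partial>\<mu> k) \<le> ennreal (1 / (1 - lam)) * (ennreal (v + b / (1 - lam)) + ennreal (b / \<epsilon>))"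
      using bnd[OF \<mu>(1,2)] drift_bound[OF \<mu> v] by (meson add_right_mono mult_left_mono order_trans zero_le)
    also have "\<dots> = ennreal B"
      unfolding B_def using pos v lam
      by (simp add: ennreal_mult[symmetric] ennreal_plus[symmetric] del: ennreal_plus)
    finally show ?thesis .
  qed
  have \<pi>_fin: "(\<integral>\<^sup>+x. potential S x \<partial>\<pi>) < \<infinity>" for S
    using \<pi>(4) by (intro le_less_trans[OF bnd[OF \<pi>(1,2)]]) (auto simp: ennreal_mult_less_top)

  have \<pi>C: "emeasure \<pi> C * (\<integral>\<^sup>+x. potential S x \<partial>\<nu>) = emeasure \<pi> S" if "S \<in> sets N" for S
    using balance[OF \<pi>(1) that] \<pi>_fin[of S] by (auto simp: \<pi>(3) ennreal_add_left_cancel)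
  have sp: "space \<pi> = space N" using \<pi>(1) by (rule sets_eq_imp_space_eq)
  have \<pi>C1: "emeasure \<pi> C * (\<integral>\<^sup>+x. potential (space N) x \<partial>\<nu>) = 1"
    using \<pi>C[OF sets.top] P.emeasure_space_1 by (simp add: sp)
  have C_pos: "emeasure \<pi> C \<noteq> 0" using \<pi>C1 by auto
  have g_fin: "(\<integral>\<^sup>+x. potential S x \<partial>\<nu>) = ennreal (g S)" if "S \<in> sets N" for S
  proof -
    have "(\<integral>\<^sup>+x. potential S x \<partial>\<nu>) < top"
    proof (rule less_top[THEN iffD1], rule notI)
      assume "(\<integral>\<^sup>+x. potential S x \<partial>\<nu>) = top"
      with \<pi>C[OF that] have "emeasure \<pi> C * top = emeasure \<pi> S" by (simp only:)
      then have "top = emeasure \<pi> S" by (simp only: ennreal_mult_top C_pos not_False_eq_True if_False)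
      then show False using P.emeasure_finite[of S] by simp
    qed
    then show ?thesis by (simp add: g_def)
  qed
  have \<pi>g: "measure \<pi> C * g S = measure \<pi> S" if "S \<in> sets N" for S
    using \<pi>C[OF that] g_fin[OF that]
    by (simp add: P.emeasure_eq_measure ennreal_mult[symmetric] g0)
  have \<pi>g1: "measure \<pi> C * g (space N) = 1"
    using \<pi>g[OF sets.top] P.prob_space by (simp add: sp)
  \<comment> \<open>\<open>\<pi>(C)\<close> is unknown, but it cancels against the equation for the whole space.\<close>
  have gS: "g S = measure \<pi> S * g (space N)"
  proof -
    have "measure \<pi> S * g (space N) = (measure \<pi> C * g (space N)) * g S"
      by (simp flip: \<pi>g[OF S])
    then show ?thesis using \<pi>g1 by simp
  qed

  have step: "a S (Suc k) + measure (\<mu> k) S = a S k + measure (\<mu> k) C * g S" if "S \<in> sets N" for S k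
  proof -
    interpret prob_space "\<mu> k" by fact
    have fin: "(\<integral>\<^sup>+x. potential S x \<partial>\<mu> k) = ennreal (a S k)" for k
      using le_less_trans[OF \<mu>_bnd[of k S]] by (simp add: a_def)
    have "ennreal (a S (Suc k) + measure (\<mu> k) S) = ennreal (a S k + measure (\<mu> k) C * g S)"
      using balance[OF \<mu>(1) that, of k] fin g_fin[OF that]
      by (simp add: \<mu>(3)[symmetric] emeasure_eq_measure ennreal_mult[symmetric] ennreal_plus[symmetric]
          a0 g0 del: ennreal_plus)
    then show ?thesis
      by (subst (asm) ennreal_inj) (auto simp: a0 g0)
  qed
  have total: "(\<Sum>k=1..n. measure (\<mu> k) S) = a S 1 - a S (Suc n) + g S * (\<Sum>k=1..n. measure (\<mu> k) C)"
    if "S \<in> sets N" for S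
  proof (induction n)
    case (Suc n)
    have "measure (\<mu> (Suc n)) S = a S (Suc n) - a S (Suc (Suc n)) + g S * measure (\<mu> (Suc n)) C"
      using step[OF that, of "Suc n"] by (simp add: mult.commute)
    then show ?case using Suc by (simp add: distrib_left)
  qed simp
  have one: "measure (\<mu> k) (space N) = 1" for k
    using prob_space.prob_space[OF \<mu>(2), of k] sets_eq_imp_space_eq[OF \<mu>(1), of k] by simp
  have n: "real n = a (space N) 1 - a (space N) (Suc n) + g (space N) * (\<Sum>k=1..n. measure (\<mu> k) C)"
    using total[OF sets.top] by (simp add: one)
  have diff: "(\<Sum>k=1..n. measure (\<mu> k) S) - real n * measure \<pi> S
     = (a S 1 - a S (Suc n)) - measure \<pi> S * (a (space N) 1 - a (space N) (Suc n))"
    unfolding total[OF S] n gS by (simp add: algebra_simps)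
  have a_le: "0 \<le> a T k \<and> a T k \<le> B" for T k
    using \<mu>_bnd[of k T] B0 by (simp add: a_def enn2real_leI)
  have "\<bar>a T 1 - a T (Suc n)\<bar> \<le> B" for T using a_le[of T 1] a_le[of T "Suc n"] by linarith
  moreover from this have "\<bar>measure \<pi> S * (a (space N) 1 - a (space N) (Suc n))\<bar> \<le> 1 * B"
    unfolding abs_mult by (intro mult_mono) auto
  ultimately have "\<bar>(\<Sum>k=1..n. measure (\<mu> k) S) - real n * measure \<pi> S\<bar> \<le> 2 * B"
    unfolding diff by (smt (verit))
  then show ?thesis by (simp add: B_def)
qed

end


section \<open>Metropolis--Hastings kernels on Euclidean space\<close>

text \<open>Only where \<open>p\<close> is positive does \<open>q\<close> have to be a probability density: elsewhere the point has no mass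
  under the target, and \<open>q\<close> may be degenerate, like the annulus proposal at the origin.\<close>
locale metropolis_hastings =
  fixes p :: "'a::euclidean_space \<Rightarrow> real" and q :: "'a \<Rightarrow> 'a \<Rightarrow> real"
  assumes p_measurable[measurable]: "p \<in> borel_measurable borel"
    and q_measurable: "case_prod q \<in> borel_measurable (borel \<Otimes>\<^sub>M borel)"
    and p_nonneg: "\<And>x. 0 \<le> p x"
    and q_nonneg: "\<And>x y. 0 \<le> q x y"
    and q_prob: "\<And>x. p x > 0 \<Longrightarrow> (\<integral>\<^sup>+y. ennreal (q x y) \<partial>lborel) = 1"
begin

lemma q_measurable'[measurable (raw)]:
  assumes "f \<in> borel_measurable M" "g \<in> borel_measurable M"
  shows "(\<lambda>z. q (f z) (g z)) \<in> borel_measurable M"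
  using measurable_compose[OF measurable_Pair[OF assms] q_measurable] by simp

lemma accept_measurable[measurable (raw)]:
  assumes [measurable]: "f \<in> borel_measurable M" "g \<in> borel_measurable M"
  shows "(\<lambda>z. mh_accept p q (f z) (g z)) \<in> borel_measurable M"
  unfolding mh_accept_def by measurable

lemma accept_01: "0 \<le> mh_accept p q x y" "mh_accept p q x y \<le> 1"
  by (simp_all add: mh_accept_def p_nonneg q_nonneg)

text \<open>The expectation of \<open>f\<close> at the next state, given the proposal \<open>y\<close> from \<open>x\<close>.\<close>
definition after_proposal :: "'a \<Rightarrow> ('a \<Rightarrow> ennreal) \<Rightarrow> 'a \<Rightarrow> ennreal" where
  "after_proposal x f y = ennreal (mh_accept p q x y) * f y + ennreal (1 - mh_accept p q x y) * f x"

lemma after_proposal_measurable[measurable]: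
  assumes [measurable]: "f \<in> borel_measurable borel"
  shows "after_proposal x f \<in> borel_measurable borel"
proof -
  have "(\<lambda>y. ennreal (mh_accept p q x y) * f y + ennreal (1 - mh_accept p q x y) * c) \<in> borel_measurable borel" for c
    by measurable
  then show ?thesis unfolding after_proposal_def[abs_def] .
qed

lemma accept_step:
  fixes x y :: 'a
  defines "\<kappa> \<equiv> measure_pmf (bernoulli_pmf (mh_accept p q x y)) \<bind> (\<lambda>acc. return borel (if acc then y else x))"
  shows "sets \<kappa> = sets borel" "prob_space \<kappa>"
    and "f \<in> borel_measurable borel \<Longrightarrow> (\<integral>\<^sup>+z. f z \<partial>\<kappa>) = after_proposal x f y"
proof -
  have ret: "(\<lambda>acc. return borel (if acc then y else x)) \<in> measure_pmf (bernoulli_pmf (mh_accept p q x y)) \<rightarrow>\<^sub>M prob_algebra borel"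
    by (auto simp: space_prob_algebra prob_space_return)
  show "sets \<kappa> = sets borel" unfolding \<kappa>_def
    by (subst sets_bind[where N = borel]) auto
  show "prob_space \<kappa>" unfolding \<kappa>_def
    by (rule prob_space_bind'[OF _ ret]) (simp add: space_prob_algebra prob_space_measure_pmf)
  assume f[measurable]: "f \<in> borel_measurable borel"
  have "(\<integral>\<^sup>+z. f z \<partial>\<kappa>) = (\<integral>\<^sup>+acc. f (if acc then y else x) \<partial>measure_pmf (bernoulli_pmf (mh_accept p q x y)))"
    unfolding \<kappa>_def by (subst nn_integral_bind[OF f measurable_prob_algebraD[OF ret]]) (simp add: nn_integral_return)
  also have "\<dots> = after_proposal x f y"
    by (simp add: accept_01 after_proposal_def mult.commute)
  finally show "(\<integral>\<^sup>+z. f z \<partial>\<kappa>) = after_proposal x f y" .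
qed

lemma accept_kernel:
  "(\<lambda>y. measure_pmf (bernoulli_pmf (mh_accept p q x y)) \<bind> (\<lambda>acc. return borel (if acc then y else x)))
     \<in> borel \<rightarrow>\<^sub>M subprob_algebra borel"
proof (rule measurable_subprob_algebra)
  fix A :: "'a set" assume A[measurable]: "A \<in> sets borel"
  have "after_proposal x (indicator A) \<in> borel_measurable borel" by measurable
  then show "(\<lambda>y. emeasure (measure_pmf (bernoulli_pmf (mh_accept p q x y)) \<bind>
      (\<lambda>acc. return borel (if acc then y else x))) A) \<in> borel_measurable borel"
    by (rule measurable_cong[THEN iffD1, rotated])
      (simp add: accept_step(3)[symmetric] accept_step(1))
qed (simp_all add: accept_step prob_space_imp_subprob_space)

lemma sets_mh_kernel: "sets (mh_kernel p q x) = sets borel"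
  unfolding mh_kernel_def
  by (rule sets_bind[where N = borel]) (auto simp: accept_step)

lemma nn_integral_mh_kernel:
  assumes f[measurable]: "f \<in> borel_measurable borel"
  shows "(\<integral>\<^sup>+z. f z \<partial>mh_kernel p q x) = (\<integral>\<^sup>+y. ennreal (q x y) * after_proposal x f y \<partial>lborel)"
proof -
  have "(\<integral>\<^sup>+z. f z \<partial>mh_kernel p q x) = (\<integral>\<^sup>+y. after_proposal x f y \<partial>density lborel (\<lambda>y. ennreal (q x y)))"
    unfolding mh_kernel_def using accept_kernel[of x]
    by (subst nn_integral_bind[OF f]) (auto simp: accept_step cong: measurable_cong_sets)
  also have "\<dots> = (\<integral>\<^sup>+y. ennreal (q x y) * after_proposal x f y \<partial>lborel)"
    by (rule nn_integral_density) measurable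
  finally show ?thesis .
qed

lemma prob_space_mh_kernel:
  assumes "p x > 0"
  shows "prob_space (mh_kernel p q x)"
proof
  show "emeasure (mh_kernel p q x) (space (mh_kernel p q x)) = 1"
    using nn_integral_mh_kernel[of "\<lambda>_. 1" x] q_prob[OF assms] accept_01[of x]
    by (simp add: after_proposal_def ennreal_plus[symmetric] del: ennreal_plus)
qed

lemma mh_kernel_measurable:
  assumes f[measurable]: "f \<in> borel_measurable borel"
  shows "(\<lambda>x. \<integral>\<^sup>+z. f z \<partial>mh_kernel p q x) \<in> borel_measurable borel"
  unfolding nn_integral_mh_kernel[OF f] after_proposal_def by measurable

text \<open>Both sides equal \<open>min (p x * q x y) (p y * q y x)\<close>, also where the ratio in the acceptance probability is
  a division by zero.\<close>
lemma detailed_balance: "p x * q x y * mh_accept p q x y = p y * q y x * mh_accept p q y x"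
proof -
  have "p x * q x y * mh_accept p q x y = min (p x * q x y) (p y * q y x)" for x y
  proof (cases "p x * q x y = 0")
    case True
    then show ?thesis using mult_nonneg_nonneg[OF p_nonneg[of y] q_nonneg[of y x]] by (auto simp: min_def)
  next
    case False
    then have "p x * q x y > 0" using p_nonneg[of x] q_nonneg[of x y] by (simp add: less_le)
    then show ?thesis using False
      by (simp add: mh_accept_def min_mult_distrib_left)
  qed
  from this[of x y] this[of y x] show ?thesis by (simp add: min.commute)
qed

text \<open>The accepted part of the mass flow is symmetric in \<open>x\<close> and \<open>y\<close> by detailed balance, so it may be
  charged to the starting point; together with the rejected part it then adds up to the proposal mass.\<close>
lemma invariant:
  assumes f[measurable]: "f \<in> borel_measurable borel"
  shows "(\<integral>\<^sup>+x. ennreal (p x) * (\<integral>\<^sup>+z. f z \<partial>mh_kernel p q x) \<partial>lborel) = (\<integral>\<^sup>+x. ennreal (p x) * f x \<partial>lborel)"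
proof -
  let ?a = "mh_accept p q"
  have "(\<integral>\<^sup>+x. ennreal (p x) * (\<integral>\<^sup>+z. f z \<partial>mh_kernel p q x) \<partial>lborel)
     = (\<integral>\<^sup>+x. (\<integral>\<^sup>+y. ennreal (p x * q x y * ?a x y) * f y \<partial>lborel)
             + (\<integral>\<^sup>+y. ennreal (p x * q x y * (1 - ?a x y)) * f x \<partial>lborel) \<partial>lborel)"
    unfolding nn_integral_mh_kernel[OF f] after_proposal_def
    by (intro nn_integral_cong, subst nn_integral_cmult[symmetric], measurable, subst nn_integral_add[symmetric])
      (auto simp: ennreal_mult p_nonneg q_nonneg accept_01 distrib_left ac_simps intro!: nn_integral_cong)
  also have "\<dots> = (\<integral>\<^sup>+x. \<integral>\<^sup>+y. ennreal (p x * q x y * ?a x y) * f y \<partial>lborel \<partial>lborel)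
      + (\<integral>\<^sup>+x. \<integral>\<^sup>+y. ennreal (p x * q x y * (1 - ?a x y)) * f x \<partial>lborel \<partial>lborel)"
    by (rule nn_integral_add) measurable
  also have "(\<integral>\<^sup>+x. \<integral>\<^sup>+y. ennreal (p x * q x y * ?a x y) * f y \<partial>lborel \<partial>lborel)
      = (\<integral>\<^sup>+y. \<integral>\<^sup>+x. ennreal (p y * q y x * ?a y x) * f y \<partial>lborel \<partial>lborel)"
    by (subst lborel_pair.Fubini') (auto simp: detailed_balance)
  also have "\<dots> + (\<integral>\<^sup>+x. \<integral>\<^sup>+y. ennreal (p x * q x y * (1 - ?a x y)) * f x \<partial>lborel \<partial>lborel)
      = (\<integral>\<^sup>+x. (\<integral>\<^sup>+y. ennreal (p x * q x y * ?a x y) * f x \<partial>lborel)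
             + (\<integral>\<^sup>+y. ennreal (p x * q x y * (1 - ?a x y)) * f x \<partial>lborel) \<partial>lborel)"
    by (rule nn_integral_add[symmetric]) measurable
  also have "\<dots> = (\<integral>\<^sup>+x. ennreal (p x) * f x * (\<integral>\<^sup>+y. ennreal (q x y) \<partial>lborel) \<partial>lborel)"
  proof (intro nn_integral_cong)
    fix x
    have "(\<integral>\<^sup>+y. ennreal (p x * q x y * ?a x y) * f x \<partial>lborel)
             + (\<integral>\<^sup>+y. ennreal (p x * q x y * (1 - ?a x y)) * f x \<partial>lborel)
         = (\<integral>\<^sup>+y. ennreal (p x * q x y * ?a x y) * f x + ennreal (p x * q x y * (1 - ?a x y)) * f x \<partial>lborel)"
      by (rule nn_integral_add[symmetric]) measurable
    also have "\<dots> = (\<integral>\<^sup>+y. (ennreal (p x) * f x) * ennreal (q x y) \<partial>lborel)"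
    proof (intro nn_integral_cong)
      fix y
      have "ennreal (p x * q x y * ?a x y) + ennreal (p x * q x y * (1 - ?a x y)) = ennreal (p x * q x y)"
        using p_nonneg[of x] q_nonneg[of x y] accept_01[of x y]
        by (subst ennreal_plus[symmetric]) (simp_all add: distrib_left[symmetric])
      then show "ennreal (p x * q x y * ?a x y) * f x + ennreal (p x * q x y * (1 - ?a x y)) * f x
          = (ennreal (p x) * f x) * ennreal (q x y)"
        unfolding distrib_right[symmetric] by (simp add: ennreal_mult p_nonneg q_nonneg mult_ac)
    qed
    also have "\<dots> = ennreal (p x) * f x * (\<integral>\<^sup>+y. ennreal (q x y) \<partial>lborel)"
      by (rule nn_integral_cmult) measurable
    finally show "(\<integral>\<^sup>+y. ennreal (p x * q x y * ?a x y) * f x \<partial>lborel)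
             + (\<integral>\<^sup>+y. ennreal (p x * q x y * (1 - ?a x y)) * f x \<partial>lborel)
         = ennreal (p x) * f x * (\<integral>\<^sup>+y. ennreal (q x y) \<partial>lborel)" .
  qed
  also have "\<dots> = (\<integral>\<^sup>+x. ennreal (p x) * f x \<partial>lborel)"
    using p_nonneg q_prob by (intro nn_integral_cong) (metis ennreal_0 less_le mult.right_neutral mult_zero_left)
  finally show ?thesis .
qed

end


section \<open>Radial integrals and the annulus kernel\<close>

text \<open>Half-lines \<open>{..<a}\<close> generate the Borel sets, and their preimages are discs of area \<open>\<pi> a\<^sup>2\<close>, the integral
  of \<open>2 \<pi> s\<close> up to \<open>a\<close>. For \<open>s < 0\<close> the density vanishes because \<open>ennreal\<close> truncates.\<close>
lemma distr_norm_plane: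
  "distr lborel borel (norm :: real^2 \<Rightarrow> real) = density lborel (\<lambda>s. ennreal (2 * pi * s))"
proof (rule measure_eqI_generator_eq)
  show "Int_stable (range (lessThan :: real \<Rightarrow> real set))"
  proof -
    have "{..<a} \<inter> {..<b} = {..<min a b}" for a b :: real by auto
    then show ?thesis by (simp add: Int_stable_def)
  qed
  show "range (lessThan :: real \<Rightarrow> real set) \<subseteq> Pow UNIV" by simp
  show "sets (distr lborel borel (norm :: real^2 \<Rightarrow> real)) = sigma_sets UNIV (range lessThan)"
       "sets (density lborel (\<lambda>s. ennreal (2 * pi * s))) = sigma_sets UNIV (range lessThan)"
    by (simp_all add: borel_Iio sets_measure_of)
  have ball: "emeasure (distr lborel borel (norm :: real^2 \<Rightarrow> real)) {..<a}
      = (if a \<le> 0 then 0 else ennreal (pi * a\<^sup>2))" for a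
  proof -
    have "norm -` {..<a} = (ball 0 a :: (real^2) set)" by auto
    then show ?thesis
      by (auto simp: emeasure_distr emeasure_ball unit_ball_vol_2 ball_empty)
  qed
  show "emeasure (distr lborel borel (norm :: real^2 \<Rightarrow> real)) A = emeasure (density lborel (\<lambda>s. ennreal (2 * pi * s))) A"
    if "A \<in> range lessThan" for A
  proof -
    obtain a where A: "A = {..<a}" using \<open>A \<in> range lessThan\<close> by auto
    have "emeasure (density lborel (\<lambda>s. ennreal (2 * pi * s))) {..<a}
        = (\<integral>\<^sup>+s. ennreal (2 * pi * s) * indicator {0..a} s \<partial>lborel)"
      by (subst emeasure_density, simp, simp, rule nn_integral_cong_AE)
        (use AE_lborel_singleton[of a] in eventually_elim, auto simp: indicator_def ennreal_neg mult_nonneg_nonpos)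
    also have "\<dots> = (if a \<le> 0 then 0 else ennreal (pi * a\<^sup>2))"
    proof (cases "a \<le> 0")
      case True
      then have "(\<integral>\<^sup>+s. ennreal (2 * pi * s) * indicator {0..a} s \<partial>lborel) = (\<integral>\<^sup>+s. 0 \<partial>(lborel :: real measure))"
        by (intro nn_integral_cong) (auto simp: indicator_def)
      then show ?thesis using True by simp
    next
      case False
      then show ?thesis
        by (subst nn_integral_FTC_Icc[where F = "\<lambda>s. pi * s\<^sup>2"])
          (auto intro!: derivative_eq_intros)
    qed
    finally show ?thesis by (simp add: A ball)
  qed
  show "range (\<lambda>i::nat. {..<real i}) \<subseteq> range lessThan" by auto
  show "(\<Union>i::nat. {..<real i}) = UNIV" by (auto intro: reals_Archimedean2)
  show "emeasure (distr lborel borel (norm :: real^2 \<Rightarrow> real)) {..<real i} \<noteq> \<infinity>" for i :: nat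
    by (simp add: ball)
qed

lemma nn_integral_radial:
  assumes h[measurable]: "h \<in> borel_measurable borel"
  shows "(\<integral>\<^sup>+x. h (norm x) \<partial>(lborel :: (real^2) measure)) = (\<integral>\<^sup>+s. ennreal (2 * pi * s) * h s \<partial>lborel)"
proof -
  have "(\<integral>\<^sup>+x. h (norm x) \<partial>(lborel :: (real^2) measure)) = (\<integral>\<^sup>+s. h s \<partial>distr lborel borel (norm :: real^2 \<Rightarrow> real))"
    by (simp add: nn_integral_distr)
  then show ?thesis by (simp add: distr_norm_plane nn_integral_density)
qed

lemma annulus_nonzero: "y \<in> annulus x \<Longrightarrow> y \<noteq> 0"
  by (auto simp: annulus_def)

text \<open>Both sides say that \<open>1\<close>, \<open>norm x\<close> and \<open>norm y\<close> are the sides of a nondegenerate triangle.\<close>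
lemma annulus_sym: "y \<in> annulus x \<longleftrightarrow> x \<in> annulus y"
  by (auto simp: annulus_def)

lemma target_density_pos: "x \<noteq> 0 \<Longrightarrow> target_density x > 0"
  by (simp add: target_density_def)

lemma target_density_nonneg: "target_density x \<ge> 0"
  by (simp add: target_density_def)

lemma target_density_measurable[measurable]: "target_density \<in> borel_measurable borel"
  unfolding target_density_def[abs_def] by measurable

lemma annulus_measurable: "(\<lambda>(x, y). indicator (annulus x) y :: real) \<in> borel_measurable (borel \<Otimes>\<^sub>M borel)"
proof -
  have "(\<lambda>(x, y). indicator (annulus x) y :: real) = (\<lambda>z. indicator {z. \<bar>norm (fst z) - 1\<bar> < norm (snd z) \<and> norm (snd z) < norm (fst z) + 1} z)"
    by (auto simp: fun_eq_iff annulus_def indicator_def)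
  also have "\<dots> \<in> borel_measurable (borel \<Otimes>\<^sub>M borel)"
  proof (rule borel_measurable_indicator)
    have "{z \<in> space (borel \<Otimes>\<^sub>M borel). \<bar>norm (fst z :: real^2) - 1\<bar> < norm (snd z :: real^2) \<and> norm (snd z) < norm (fst z) + 1}
        \<in> sets (borel \<Otimes>\<^sub>M borel)"
      by measurable
    then show "{z. \<bar>norm (fst z :: real^2) - 1\<bar> < norm (snd z :: real^2) \<and> norm (snd z) < norm (fst z) + 1}
        \<in> sets (borel \<Otimes>\<^sub>M borel)"
      by (simp add: space_pair_measure)
  qed
  finally show ?thesis .
qed

interpretation annulus: metropolis_hastings target_density proposal_density
proof
  show "case_prod proposal_density \<in> borel_measurable (borel \<Otimes>\<^sub>M borel)"
  proof -
    have "(\<lambda>z. (\<lambda>(x, y). indicator (annulus x) y :: real) z / (4 * pi * norm (fst z))) \<in> borel_measurable (borel \<Otimes>\<^sub>M borel)"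
      by (intro borel_measurable_divide annulus_measurable) measurable
    also have "(\<lambda>z. (\<lambda>(x, y). indicator (annulus x) y :: real) z / (4 * pi * norm (fst z))) = case_prod proposal_density"
      by (auto simp: fun_eq_iff proposal_density_def)
    finally show ?thesis .
  qed
  fix x :: "real^2" assume "target_density x > 0"
  then have x: "x \<noteq> 0" by (auto simp: target_density_def)
  have "emeasure (density lborel (\<lambda>y. ennreal (proposal_density x y))) UNIV = 1"
    unfolding proposal_uniform[OF x]
    using prob_space.emeasure_space_1[OF prob_space_uniform_measure[of lborel "annulus x"]] emeasure_annulus[OF x] x
    by simp
  moreover have "(\<lambda>y. ennreal (proposal_density x y)) \<in> borel_measurable lborel"
  proof -
    have "annulus x \<in> sets borel" unfolding annulus_def by measurable
    then show ?thesis unfolding proposal_density_def by measurable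
  qed
  ultimately show "(\<integral>\<^sup>+y. ennreal (proposal_density x y) \<partial>lborel) = 1"
    by (simp add: emeasure_density)
qed (auto simp: target_density_nonneg proposal_density_def)

lemma accept_annulus:
  assumes x: "x \<noteq> 0" and y: "y \<in> annulus x"
  shows "mh_accept target_density proposal_density x y =
    min 1 (norm x / norm y * exp ((norm x + 1 / norm x) - (norm y + 1 / norm y)))"
proof -
  have "x \<in> annulus y" "y \<noteq> 0" using y annulus_sym annulus_nonzero by auto
  have ratio: "exp (- b) * (1 / (4 * pi * s)) / (exp (- a) * (1 / (4 * pi * r))) = r / s * exp (a - b)"
    if "r > 0" "s > 0" for a b r s :: real
    using that by (simp add: exp_diff exp_minus field_simps)
  show ?thesis using x y \<open>x \<in> annulus y\<close> \<open>y \<noteq> 0\<close> ratio[of "norm x" "norm y"]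
    by (simp only: mh_accept_def proposal_density_def target_density_def if_False indicator_simps zero_less_norm_iff not_False_eq_True)
qed

lemma nn_integral_annulus_kernel:
  assumes "x \<noteq> 0" "f \<in> borel_measurable borel"
  shows "(\<integral>\<^sup>+z. f z \<partial>annulus_kernel x) = (\<integral>\<^sup>+y. ennreal (proposal_density x y) * annulus.after_proposal x f y \<partial>lborel)"
  using assms by (simp add: annulus_kernel_def annulus.nn_integral_mh_kernel)

lemma nn_integral_annulus_kernel_le:
  assumes x: "x \<noteq> 0" and f: "f \<in> borel_measurable borel"
    and le: "\<And>y. y \<in> annulus x \<Longrightarrow> annulus.after_proposal x f y \<le> c"
  shows "(\<integral>\<^sup>+z. f z \<partial>annulus_kernel x) \<le> c"
proof -
  have "(\<integral>\<^sup>+z. f z \<partial>annulus_kernel x) \<le> (\<integral>\<^sup>+y. ennreal (proposal_density x y) * c \<partial>lborel)"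
    unfolding nn_integral_annulus_kernel[OF x f]
    using le by (intro nn_integral_mono) (auto simp: proposal_density_def indicator_def intro!: mult_left_mono)
  also have "\<dots> = c"
    using annulus.q_prob[OF target_density_pos[OF x]] by (subst nn_integral_multc) auto
  finally show ?thesis .
qed

lemma annulus_kernel_measurable: "annulus_kernel \<in> borel \<rightarrow>\<^sub>M prob_algebra borel"
proof (rule measurable_prob_algebraI)
  show prob: "prob_space (annulus_kernel x)" for x
    by (auto simp: annulus_kernel_def prob_space_return annulus.prob_space_mh_kernel target_density_pos)
  have sets: "sets (annulus_kernel x) = sets borel" for x
    by (simp add: annulus_kernel_def annulus.sets_mh_kernel)
  show "annulus_kernel \<in> borel \<rightarrow>\<^sub>M subprob_algebra borel"
  proof (rule measurable_subprob_algebra)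
    fix A :: "(real^2) set" assume A[measurable]: "A \<in> sets borel"
    have "(\<lambda>x. \<integral>\<^sup>+z. indicator A z \<partial>mh_kernel target_density proposal_density x) \<in> borel_measurable borel"
      by (rule annulus.mh_kernel_measurable) measurable
    then have [measurable]: "(\<lambda>x. emeasure (mh_kernel target_density proposal_density x) A) \<in> borel_measurable borel"
      by (simp add: annulus.sets_mh_kernel)
    have "(\<lambda>x. if x = 0 then emeasure (return borel (0::real^2)) A else emeasure (mh_kernel target_density proposal_density x) A) \<in> borel_measurable borel"
      by measurable
    then show "(\<lambda>x. emeasure (annulus_kernel x) A) \<in> borel_measurable borel"
      by (rule measurable_cong[THEN iffD1, rotated]) (simp add: annulus_kernel_def)
  qed (simp_all add: sets prob prob_space_imp_subprob_space)
qed


section \<open>Drift towards the core\<close>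

text \<open>Exponential growth makes the drift condition geometric; the small rate \<open>1/16\<close> keeps the quadratic terms
  below the weak linear drift near \<open>r = 12/5\<close>. Close to the origin the value \<open>5/4\<close> exceeds those at
  radii between \<open>1/2\<close> and \<open>3/2\<close>, where the next accepted proposal lies.\<close>
definition lyapunov :: "real \<Rightarrow> real" where
  "lyapunov r = (if r < 1/2 then 5/4 else exp (r / 16))"

definition weight :: "real^2 \<Rightarrow> ennreal" where
  "weight x = (if x = 0 then top else ennreal (lyapunov (norm x)))"

text \<open>The outer radius lies where the inward drift has set in. With the inner one, all points of the core
  have an annulus of possible proposals in common: it begins at the radius \<open>12/5 - 1 = 7/5\<close> and ends at
  \<open>1/2 + 1 = 3/2\<close>.\<close>
definition core :: "(real^2) set" where
  "core = {x. 1/2 \<le> norm x \<and> norm x \<le> 12/5}"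

definition common_annulus :: "(real^2) set" where
  "common_annulus = {x. 7/5 < norm x \<and> norm x < 3/2}"

definition minorant :: "(real^2) measure" where
  "minorant = density lborel (\<lambda>y. ennreal (1 / (10 * pi)) * indicator common_annulus y)"

lemma lyapunov_measurable[measurable]: "lyapunov \<in> borel_measurable borel"
  unfolding lyapunov_def[abs_def] by measurable

lemma weight_measurable[measurable]: "weight \<in> borel_measurable borel"
  unfolding weight_def[abs_def] by measurable

lemma core_measurable[measurable]: "core \<in> sets borel"
  unfolding core_def by measurable

lemma common_annulus_measurable[measurable]: "common_annulus \<in> sets borel"
  unfolding common_annulus_def by measurable

lemma lyapunov_ge_1: "0 \<le> r \<Longrightarrow> 1 \<le> lyapunov r"
  by (simp add: lyapunov_def)

lemma weight_ge_1: "1 \<le> weight x"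
  using ennreal_leI[OF lyapunov_ge_1[of "norm x"]] by (auto simp: weight_def)

lemma after_proposal_weight:
  assumes x: "x \<noteq> 0" and y: "y \<in> annulus x"
  defines "\<alpha> \<equiv> mh_accept target_density proposal_density x y"
  shows "annulus.after_proposal x weight y = ennreal (lyapunov (norm x) + \<alpha> * (lyapunov (norm y) - lyapunov (norm x)))"
proof -
  have \<alpha>: "0 \<le> \<alpha>" "\<alpha> \<le> 1" using annulus.accept_01[of x y] by (simp_all add: \<alpha>_def)
  have l: "0 \<le> lyapunov (norm z)" for z :: "real^2" using lyapunov_ge_1[of "norm z"] by simp
  have "annulus.after_proposal x weight y = ennreal \<alpha> * ennreal (lyapunov (norm y)) + ennreal (1 - \<alpha>) * ennreal (lyapunov (norm x))"
    using x annulus_nonzero[OF y] by (simp add: annulus.after_proposal_def weight_def \<alpha>_def)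
  also have "\<dots> = ennreal (\<alpha> * lyapunov (norm y) + (1 - \<alpha>) * lyapunov (norm x))"
    using \<alpha> l by (simp add: ennreal_mult[symmetric] ennreal_plus[symmetric] del: ennreal_plus)
  also have "\<alpha> * lyapunov (norm y) + (1 - \<alpha>) * lyapunov (norm x)
      = lyapunov (norm x) + \<alpha> * (lyapunov (norm y) - lyapunov (norm x))"
    by (simp add: algebra_simps)
  finally show ?thesis .
qed

text \<open>Since \<open>(1 - x + x\<^sup>2/2) (1 + x + x\<^sup>2/2) = 1 + x^4/4\<close>, this follows from the lower Taylor bound for
  \<open>exp x\<close>.\<close>
lemma exp_le_quadratic: "0 \<le> x \<Longrightarrow> exp (- x) \<le> 1 - x + x\<^sup>2 / 2" for x :: real
proof -
  assume x: "0 \<le> x"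
  have "1 \<le> 1 + x ^ 4 / 4" by simp
  also have "\<dots> = (1 - x + x\<^sup>2 / 2) * (1 + x + x\<^sup>2 / 2)"
    by (simp add: power2_eq_square power4_eq_xxxx field_simps)
  also have "\<dots> \<le> (1 - x + x\<^sup>2 / 2) * exp x"
  proof (rule mult_left_mono)
    have "0 \<le> (1 - x)\<^sup>2 + 1" by simp
    then show "0 \<le> 1 - x + x\<^sup>2 / 2" by (simp add: power2_eq_square algebra_simps)
  qed (rule exp_lower_Taylor_quadratic[OF x])
  finally show ?thesis by (simp add: exp_minus field_simps)
qed

text \<open>Near the origin all proposals have radius between \<open>1/2\<close> and \<open>3/2\<close>, and \<open>exp t \<ge> 1 + t\<close> shows that each
  is accepted with probability at least \<open>1/3\<close>: the factor \<open>r\<close> in the acceptance ratio is compensated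
  by the term \<open>1/r\<close> in the exponent.\<close>
lemma weight_drift_small:
  assumes x: "x \<noteq> 0" "norm x < 1/2"
  shows "(\<integral>\<^sup>+y. weight y \<partial>annulus_kernel x) \<le> ennreal (49/40)"
proof (rule nn_integral_annulus_kernel_le[OF x(1) weight_measurable])
  fix y assume y: "y \<in> annulus x"
  define r s where "r = norm x" and "s = norm y"
  define \<alpha> where "\<alpha> = mh_accept target_density proposal_density x y"
  have r: "0 < r" "r < 1/2" using x by (auto simp: r_def)
  have s: "1/2 < s" "s < 3/2" using y r unfolding annulus_def r_def s_def by auto
  have "1/3 \<le> r / s * exp ((r + 1/r) - (s + 1/s))"
  proof -
    have "s + 1/s \<le> 5/2"
    proof -
      have "(s - 1/2) * (s - 2) \<le> 0" using s by (intro mult_nonneg_nonpos) auto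
      moreover have "(s - 1/2) * (s - 2) = (s + 1/s - 5/2) * s" using s by (simp add: field_simps)
      ultimately have "(s + 1/s - 5/2) * s \<le> 0" by simp
      then show ?thesis using s by (simp add: mult_le_0_iff)
    qed
    have "1/2 \<le> r * r - 3/2 * r + 1"
    proof -
      have "0 \<le> (r - 1/2) * (r - 1)" using r by (intro mult_nonpos_nonpos) auto
      moreover have "(r - 1/2) * (r - 1) = r * r - 3/2 * r + 1/2" by (simp add: field_simps)
      ultimately show ?thesis by linarith
    qed
    also have "\<dots> = r * (1 + ((r + 1/r) - 5/2))" using r by (simp add: field_simps)
    also have "\<dots> \<le> r * (1 + ((r + 1/r) - (s + 1/s)))"
      using \<open>s + 1/s \<le> 5/2\<close> r by (intro mult_left_mono) auto
    also have "\<dots> \<le> r * exp ((r + 1/r) - (s + 1/s))"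
      using r by (intro mult_left_mono exp_ge_add_one_self) auto
    finally have "1/2 / s \<le> r * exp ((r + 1/r) - (s + 1/s)) / s"
      using s by (intro divide_right_mono) auto
    moreover have "1/3 \<le> 1/2 / s" using s by (simp add: field_simps)
    ultimately show ?thesis by simp
  qed
  then have \<alpha>: "1/3 \<le> \<alpha>"
    unfolding \<alpha>_def accept_annulus[OF x(1) y] r_def s_def by simp
  have "exp (s / 16) \<le> 1 + s/16 + (s/16)\<^sup>2" using s by (intro exp_bound) auto
  also have "\<dots> \<le> 23/20"
  proof -
    have "(s/16)\<^sup>2 \<le> (3/32)\<^sup>2" using s by (intro power_mono) auto
    moreover have "s/16 \<le> 3/32" using s by simp
    ultimately show ?thesis by (simp add: power2_eq_square)
  qed
  finally have ls: "lyapunov s \<le> 23/20" using s by (simp add: lyapunov_def)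
  have lr: "lyapunov r = 5/4" using r by (simp add: lyapunov_def)
  have "\<alpha> * (lyapunov s - lyapunov r) \<le> \<alpha> * (- 1/10)"
    using ls lr \<alpha> by (intro mult_left_mono) auto
  also have "\<dots> \<le> - 1/40" using \<alpha> by simp
  finally have "lyapunov r + \<alpha> * (lyapunov s - lyapunov r) \<le> 49/40" using lr by linarith
  then show "annulus.after_proposal x weight y \<le> ennreal (49/40)"
    unfolding after_proposal_weight[OF x(1) y] \<alpha>_def r_def s_def by (rule ennreal_leI)
qed

text \<open>Proposals from the core have radius at most \<open>12/5 + 1 = 17/5\<close>, and up to there the weight is at
  most \<open>13/10\<close>; acceptance only averages two such values.\<close>
lemma weight_drift_core:
  assumes x: "x \<in> core"
  shows "(\<integral>\<^sup>+y. weight y \<partial>annulus_kernel x) \<le> ennreal (13/10)"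
proof (rule nn_integral_annulus_kernel_le)
  show x0: "x \<noteq> 0" using x by (auto simp: core_def)
  fix y assume y: "y \<in> annulus x"
  define r s where "r = norm x" and "s = norm y"
  define \<alpha> where "\<alpha> = mh_accept target_density proposal_density x y"
  have \<alpha>: "0 \<le> \<alpha>" "\<alpha> \<le> 1" using annulus.accept_01[of x y] by (simp_all add: \<alpha>_def)
  have le: "lyapunov t \<le> 13/10" if "0 \<le> t" "t \<le> 17/5" for t
  proof -
    have "exp (t / 16) \<le> 1 + t/16 + (t/16)\<^sup>2" using that by (intro exp_bound) auto
    also have "\<dots> \<le> 13/10"
    proof -
      have "(t/16)\<^sup>2 \<le> (17/80)\<^sup>2" using that by (intro power_mono) auto
      moreover have "t/16 \<le> 17/80" using that by simp
      ultimately show ?thesis by (simp add: power2_eq_square)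
    qed
    finally show ?thesis by (simp add: lyapunov_def)
  qed
  have "0 \<le> r" "r \<le> 17/5" "0 \<le> s" "s \<le> 17/5"
    using x y by (auto simp: core_def annulus_def r_def s_def)
  then have "lyapunov r \<le> 13/10" "lyapunov s \<le> 13/10"
    using le[of r] le[of s] by simp_all
  then have "(1 - \<alpha>) * lyapunov r + \<alpha> * lyapunov s \<le> (1 - \<alpha>) * (13/10) + \<alpha> * (13/10)"
    using \<alpha> by (intro add_mono mult_left_mono) auto
  moreover have "(1 - \<alpha>) * lyapunov r + \<alpha> * lyapunov s = lyapunov r + \<alpha> * (lyapunov s - lyapunov r)"
    by (simp add: algebra_simps)
  moreover have convex: "(1 - \<alpha>) * c + \<alpha> * c = c" for c by (simp add: algebra_simps)
  note convex[of "13/10"]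
  ultimately have "lyapunov r + \<alpha> * (lyapunov s - lyapunov r) \<le> 13/10" by linarith
  then show "annulus.after_proposal x weight y \<le> ennreal (13/10)"
    unfolding after_proposal_weight[OF x0 y] \<alpha>_def r_def s_def by (rule ennreal_leI)
qed measurable

lemma inward_bound:
  fixes r v :: real
  assumes "12/5 < r" "0 \<le> v" "v \<le> 1"
  shows "exp ((r - v) / 16) \<le> exp (r / 16) * (1 - v/16 + v\<^sup>2/512)"
proof -
  have "exp ((r - v) / 16) = exp (r / 16) * exp (- (v / 16))"
    by (simp add: exp_add[symmetric] diff_divide_distrib)
  also have "\<dots> \<le> exp (r / 16) * (1 - v/16 + (v/16)\<^sup>2/2)"
    using assms by (intro mult_left_mono exp_le_quadratic) auto
  also have "(v/16)\<^sup>2/2 = v\<^sup>2/512" by (simp add: power2_eq_square)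
  finally show ?thesis .
qed

text \<open>Beyond the radius \<open>1\<close> the energy increases: \<open>H(r) - H(s) = (r - s) (1 - 1/(r s))\<close>.\<close>
lemma inward_accepted:
  fixes r s :: real
  assumes "12/5 < r" "r - 1 < s" "s \<le> r"
  shows "1 \<le> r / s * exp ((r + 1/r) - (s + 1/s))"
proof -
  have s: "0 < s" "1 \<le> s" using assms by auto
  have "1 * 1 \<le> r * s" using assms s by (intro mult_mono) auto
  then have "0 \<le> (r - s) * (1 - 1 / (r * s))" using assms by (intro mult_nonneg_nonneg) auto
  also have "\<dots> = (r + 1/r) - (s + 1/s)" using assms s by (simp add: field_simps)
  finally have "1 \<le> exp ((r + 1/r) - (s + 1/s))" by simp
  moreover have "1 \<le> r / s" using assms s by simp
  ultimately show ?thesis using mult_mono[of 1 "r/s" 1] by simp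
qed

text \<open>The repulsion \<open>1/r\<close> weakens the exponential decay \<open>exp (-u)\<close> only by the factor \<open>1 - 1/(r (r + u))\<close> in the
  exponent, and \<open>r (r + u) \<ge> 5\<close>.\<close>
lemma outward_rarely_accepted:
  fixes r u :: real
  assumes r: "12/5 < r" and u: "0 \<le> u"
  shows "exp ((r + 1/r) - (r + u + 1/(r + u))) \<le> 1 - 4/5 * u + 8/25 * u\<^sup>2"
proof -
  have "5 \<le> r * (r + u)"
  proof -
    have "(12/5) * (12/5) \<le> r * (r + u)" using r u by (intro mult_mono) auto
    then show ?thesis by simp
  qed
  then have "1 / (r * (r + u)) \<le> 1/5" by (intro divide_left_mono) auto
  then have "u * (1 / (r * (r + u))) \<le> u * (1/5)" using u by (rule mult_left_mono)
  moreover have "(r + 1/r) - (r + u + 1/(r + u)) = - u + u * (1 / (r * (r + u)))"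
  proof -
    have "(r + 1/r) - (t + 1/t) = - (t - r) + (t - r) * (1 / (r * t))" if "t > 0" for t
      using that r by (simp add: field_simps)
    from this[of "r + u"] show ?thesis using r u by simp
  qed
  ultimately have "(r + 1/r) - (r + u + 1/(r + u)) \<le> - (4/5 * u)" by linarith
  then have "exp ((r + 1/r) - (r + u + 1/(r + u))) \<le> exp (- (4/5 * u))" by simp
  also have "\<dots> \<le> 1 - 4/5 * u + (4/5 * u)\<^sup>2 / 2" using u by (intro exp_le_quadratic) simp
  also have "(4/5 * u)\<^sup>2 / 2 = 8/25 * u\<^sup>2" by (simp add: power2_eq_square)
  finally show ?thesis by simp
qed

text \<open>An upper bound, polynomial in \<open>s\<close> on each side of \<open>r\<close>, for the radial proposal density \<open>s / (2 r)\<close> times the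
  relative change of the weight when the proposed radius is \<open>s\<close>. For \<open>s > r\<close> the factor \<open>r / s\<close> in the
  acceptance ratio turns the density \<open>s / (2 r)\<close> into \<open>1/2\<close>.\<close>
definition radial_gain :: "real \<Rightarrow> real \<Rightarrow> real" where
  "radial_gain r s = (if s \<le> r then s / (2 * r) * (1 + (s - r)/16 + (s - r)\<^sup>2/512)
     else s / (2 * r) + 1/2 * (1 - 4/5 * (s - r) + 8/25 * (s - r)\<^sup>2) * ((s - r)/16 + (s - r)\<^sup>2/256))"

text \<open>Inward moves are all accepted and lower the weight, outward ones raise it but are rarely accepted.
  The division by the length \<open>2 \<pi> s\<close> of the circle turns a density in the radius into one in the plane.\<close>
lemma after_proposal_weight_far:
  assumes x: "12/5 < norm x" and y: "y \<in> annulus x"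
  shows "ennreal (proposal_density x y) * annulus.after_proposal x weight y
     \<le> ennreal (exp (norm x / 16) * (radial_gain (norm x) (norm y) / (2 * pi * norm y)))"
proof -
  define r s where "r = norm x" and "s = norm y"
  define \<alpha> where "\<alpha> = mh_accept target_density proposal_density x y"
  have x0: "x \<noteq> 0" using x by auto
  have r: "12/5 < r" using x by (simp add: r_def)
  have s: "r - 1 < s" "s < r + 1" using y r by (auto simp: annulus_def r_def s_def)
  have \<alpha>: "0 \<le> \<alpha>" "\<alpha> \<le> 1" using annulus.accept_01[of x y] by (simp_all add: \<alpha>_def)
  have \<alpha>_eq: "\<alpha> = min 1 (r / s * exp ((r + 1/r) - (s + 1/s)))"
    unfolding \<alpha>_def accept_annulus[OF x0 y] r_def s_def ..
  have l: "lyapunov r = exp (r/16)" "lyapunov s = exp (s/16)" using r s by (simp_all add: lyapunov_def)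
  have key: "s / (2 * r) * (lyapunov r + \<alpha> * (lyapunov s - lyapunov r)) \<le> exp (r / 16) * radial_gain r s"
  proof (cases "s \<le> r")
    case True
    then have "\<alpha> = 1" using inward_accepted[of r s] r s unfolding \<alpha>_eq by simp
    then have "s / (2 * r) * (lyapunov r + \<alpha> * (lyapunov s - lyapunov r)) = s / (2 * r) * exp ((r - (r - s)) / 16)"
      by (simp add: l)
    also have "\<dots> \<le> s / (2 * r) * (exp (r / 16) * (1 - (r - s)/16 + (r - s)\<^sup>2/512))"
      using True r s by (intro mult_left_mono inward_bound) auto
    also have "1 - (r - s)/16 + (r - s)\<^sup>2/512 = 1 + (s - r)/16 + (s - r)\<^sup>2/512"
      by (simp add: power2_commute[of s r] diff_divide_distrib)
    also have "s / (2 * r) * (exp (r / 16) * (1 + (s - r)/16 + (s - r)\<^sup>2/512)) = exp (r / 16) * radial_gain r s"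
      using True by (simp add: radial_gain_def)
    finally show ?thesis .
  next
    case False
    define u where "u = s - r"
    have u: "0 \<le> u" "u \<le> 1" using False s by (auto simp: u_def)
    define e where "e = exp ((r + 1/r) - (s + 1/s))"
    have e: "0 \<le> e" "e \<le> 1 - 4/5 * u + 8/25 * u\<^sup>2"
      using outward_rarely_accepted[OF r u(1)] by (simp_all add: e_def u_def)
    have "exp (u / 16) \<le> 1 + u/16 + (u/16)\<^sup>2" using u by (intro exp_bound) auto
    then have g: "exp (u / 16) - 1 \<le> u/16 + u\<^sup>2/256" by (simp add: power2_eq_square)
    have split: "lyapunov s - lyapunov r = exp (r / 16) * (exp (u / 16) - 1)"
      by (simp add: l u_def exp_add[symmetric] algebra_simps diff_divide_distrib)
    have "s / (2 * r) * \<alpha> \<le> s / (2 * r) * (r / s * e)"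
      using r s by (intro mult_left_mono) (auto simp: \<alpha>_eq e_def)
    also have "\<dots> = 1/2 * e" using r s by (simp add: field_simps)
    finally have A: "s / (2 * r) * \<alpha> \<le> 1/2 * (1 - 4/5 * u + 8/25 * u\<^sup>2)" using e by simp
    have "(s / (2 * r) * \<alpha>) * (exp (u / 16) - 1) \<le> 1/2 * (1 - 4/5 * u + 8/25 * u\<^sup>2) * (u/16 + u\<^sup>2/256)"
    proof (rule mult_mono[OF A g])
      show "0 \<le> 1/2 * (1 - 4/5 * u + 8/25 * u\<^sup>2)" using order_trans[OF e] by simp
      show "0 \<le> exp (u / 16) - 1" using u by simp
    qed
    then have "exp (r/16) * (s / (2 * r) + (s / (2 * r) * \<alpha>) * (exp (u / 16) - 1))
        \<le> exp (r/16) * (s / (2 * r) + 1/2 * (1 - 4/5 * u + 8/25 * u\<^sup>2) * (u/16 + u\<^sup>2/256))"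
      by (intro mult_left_mono add_left_mono) auto
    also have "\<dots> = exp (r/16) * radial_gain r s" using False by (simp add: radial_gain_def u_def)
    also have "exp (r/16) * (s / (2 * r) + (s / (2 * r) * \<alpha>) * (exp (u / 16) - 1))
        = s / (2 * r) * (lyapunov r + \<alpha> * (lyapunov s - lyapunov r))"
      unfolding split by (simp add: l algebra_simps)
    finally show ?thesis .
  qed
  have "proposal_density x y * (lyapunov r + \<alpha> * (lyapunov s - lyapunov r))
      = (s / (2 * r) * (lyapunov r + \<alpha> * (lyapunov s - lyapunov r))) / (2 * pi * s)"
    using y r s by (simp add: proposal_density_def r_def)
  also have "\<dots> \<le> (exp (r / 16) * radial_gain r s) / (2 * pi * s)"
    using key r s by (intro divide_right_mono) auto
  finally have "ennreal (proposal_density x y * (lyapunov r + \<alpha> * (lyapunov s - lyapunov r)))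
      \<le> ennreal (exp (r / 16) * (radial_gain r s / (2 * pi * s)))"
    by (intro ennreal_leI) simp
  moreover have "ennreal (proposal_density x y) * annulus.after_proposal x weight y
      = ennreal (proposal_density x y * (lyapunov r + \<alpha> * (lyapunov s - lyapunov r)))"
    unfolding after_proposal_weight[OF x0 y] \<alpha>_def r_def s_def
    by (rule ennreal_mult'[symmetric]) (simp add: proposal_density_def)
  ultimately show ?thesis by (simp add: r_def s_def)
qed

lemma radial_gain_nonneg: "0 < r \<Longrightarrow> r - 1 \<le> s \<Longrightarrow> s \<le> r + 1 \<Longrightarrow> 0 \<le> s \<Longrightarrow> 0 \<le> radial_gain r s"
proof -
  assume r: "0 < r" "r - 1 \<le> s" "s \<le> r + 1" "0 \<le> s"
  show ?thesis
  proof (cases "s \<le> r")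
    case True
    have "0 \<le> 1 + (s - r)/16" using r by (simp add: field_simps)
    then show ?thesis using r
      unfolding radial_gain_def if_P[OF True]
      by (intro mult_nonneg_nonneg add_nonneg_nonneg[of "1 + (s - r)/16"]) auto
  next
    case False
    then have "0 \<le> 1 - 4/5 * (s - r)" using r by simp
    then show ?thesis using r False
      unfolding radial_gain_def if_not_P[OF False] by (intro mult_nonneg_nonneg add_nonneg_nonneg) auto
  qed
qed

text \<open>The inward linear term is \<open>- (1/4 - 1/(6 r)) / 16\<close> and the outward one is
  \<open>(1/2) (1/2 - 4/15 + 2/25) / 16\<close>. For \<open>r \<ge> 12/5\<close> their sum is at most about \<open>-0.0015\<close>,
  which outweighs the second order terms of about \<open>0.0007\<close>.\<close>
lemma radial_gain_total:
  assumes r: "12/5 < r"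
  shows "(\<integral>\<^sup>+s. ennreal (radial_gain r s) * indicator {r - 1 .. r + 1} s \<partial>lborel) \<le> ennreal (1999/2000)"
proof -
  define f where "f s = s / (2 * r) * (1 + (s - r)/16 + (s - r)\<^sup>2/512)" for s
  define g where "g s = s / (2 * r) + 1/2 * (1 - 4/5 * (s - r) + 8/25 * (s - r)\<^sup>2) * ((s - r)/16 + (s - r)\<^sup>2/256)" for s
  \<comment> \<open>Antiderivatives of the two branches in terms of \<open>u = s - r\<close>.\<close>
  define F where "F u = (1 / (2 * r)) * (r * u + u^2/2 + (r * u^2/2 + u^3/3)/16 + (r * u^3/3 + u^4/4)/512)" for u
  define G where "G u = (1 / (2 * r)) * (r * u + u^2/2) + 1/2 * (u^2/32 + (1/256 - 1/20) * u^3/3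
      + (1/50 - 1/320) * u^4/4 + u^5/4000)" for u
  have gf: "radial_gain r s = (if s \<le> r then f s else g s)" for s
    by (simp add: radial_gain_def f_def g_def)
  have f0: "0 \<le> f s" if "s \<in> {r-1..r}" for s
    using radial_gain_nonneg[of r s] that r by (simp add: gf)
  have g0: "0 \<le> g s" if "s \<in> {r..r+1}" for s
  proof -
    have "0 \<le> 1 - 4/5 * (s - r)" using that r by simp
    then show ?thesis using that r unfolding g_def by (intro mult_nonneg_nonneg add_nonneg_nonneg) auto
  qed
  have [measurable]: "f \<in> borel_measurable borel" "g \<in> borel_measurable borel"
    unfolding f_def[abs_def] g_def[abs_def] by measurable
  have "(\<integral>\<^sup>+s. ennreal (radial_gain r s) * indicator {r - 1 .. r + 1} s \<partial>lborel)
      \<le> (\<integral>\<^sup>+s. ennreal (f s) * indicator {r-1..r} s + ennreal (g s) * indicator {r..r+1} s \<partial>lborel)"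
    by (intro nn_integral_mono) (auto simp: gf indicator_def)
  also have "\<dots> = (\<integral>\<^sup>+s. ennreal (f s) * indicator {r-1..r} s \<partial>lborel) + (\<integral>\<^sup>+s. ennreal (g s) * indicator {r..r+1} s \<partial>lborel)"
    by (rule nn_integral_add) measurable
  also have "(\<integral>\<^sup>+s. ennreal (f s) * indicator {r-1..r} s \<partial>lborel) = ennreal (F (r - r) - F ((r - 1) - r))"
  proof (rule nn_integral_FTC_Icc)
    fix s assume "s \<in> {r-1..r}"
    have "DERIV (\<lambda>u. c * (r * u + u^2/2 + (r * u^2/2 + u^3/3)/16 + (r * u^3/3 + u^4/4)/512)) u
        :> c * (r + u) * (1 + u/16 + u^2/512)" for c u
      by (auto intro!: derivative_eq_intros) (simp add: field_simps power2_eq_square power3_eq_cube)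
    then have "DERIV F u :> (1 / (2 * r)) * (r + u) * (1 + u/16 + u^2/512)" for u
      unfolding F_def .
    moreover have "DERIV (\<lambda>s. s - r) s :> 1" by (auto intro!: derivative_eq_intros)
    ultimately have "DERIV (\<lambda>s. F (s - r)) s :> ((1 / (2 * r)) * (r + (s - r)) * (1 + (s - r)/16 + (s - r)^2/512)) * 1"
      by (rule DERIV_chain2)
    then show "DERIV (\<lambda>s. F (s - r)) s :> f s"
      by (simp add: f_def)
  qed (use r f0 in auto)
  also have "(\<integral>\<^sup>+s. ennreal (g s) * indicator {r..r+1} s \<partial>lborel) = ennreal (G ((r + 1) - r) - G (r - r))"
  proof (rule nn_integral_FTC_Icc)
    fix s assume "s \<in> {r..r+1}"
    have "DERIV (\<lambda>u. c * (r * u + u^2/2) + 1/2 * (u^2/32 + (1/256 - 1/20) * u^3/3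
      + (1/50 - 1/320) * u^4/4 + u^5/4000)) u
        :> c * (r + u) + 1/2 * (1 - 4/5 * u + 8/25 * u\<^sup>2) * (u/16 + u\<^sup>2/256)" for c u
      by (auto intro!: derivative_eq_intros) (simp add: field_simps power2_eq_square power3_eq_cube power4_eq_xxxx)
    then have "DERIV G u :> (1 / (2 * r)) * (r + u) + 1/2 * (1 - 4/5 * u + 8/25 * u\<^sup>2) * (u/16 + u\<^sup>2/256)" for u
      unfolding G_def .
    moreover have "DERIV (\<lambda>s. s - r) s :> 1" by (auto intro!: derivative_eq_intros)
    ultimately have "DERIV (\<lambda>s. G (s - r)) s :> ((1 / (2 * r)) * (r + (s - r)) + 1/2 * (1 - 4/5 * (s - r) + 8/25 * (s - r)\<^sup>2) * ((s - r)/16 + (s - r)\<^sup>2/256)) * 1"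
      by (rule DERIV_chain2)
    then show "DERIV (\<lambda>s. G (s - r)) s :> g s"
      by (simp add: g_def)
  qed (use r g0 in auto)
  also have "ennreal (F (r - r) - F ((r - 1) - r)) = ennreal (1/2 - 1/64 + 1/3072 - (1/r) * (1/4 - 1/96 + 1/4096))"
    using r by (simp add: F_def field_simps)
  also have "ennreal (G ((r + 1) - r) - G (r - r))
      = ennreal (1/2 + (1/r) * (1/4) + 1/2 * (1/32 + (1/256 - 1/20)/3 + (1/50 - 1/320)/4 + 1/4000))"
    using r by (simp add: G_def field_simps)
  also have "ennreal (1/2 - 1/64 + 1/3072 - (1/r) * (1/4 - 1/96 + 1/4096)) + \<dots> \<le> ennreal (1999/2000)"
  proof -
    have "0 < 1 / r" "1 / r \<le> 5/12" using r by (simp_all add: field_simps)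
    define a b where "a = 1/2 - 1/64 + 1/3072 - (1/r) * (1/4 - 1/96 + 1/4096)"
      and "b = 1/2 + (1/r) * (1/4) + 1/2 * (1/32 + (1/256 - 1/20)/3 + (1/50 - 1/320)/4 + 1/4000 :: real)"
    have "0 \<le> a" "0 \<le> b" "a + b \<le> 1999/2000"
      using \<open>0 < 1 / r\<close> \<open>1 / r \<le> 5/12\<close> unfolding a_def b_def by simp_all
    then have "ennreal a + ennreal b \<le> ennreal (1999/2000)"
      by (simp add: ennreal_plus[symmetric] ennreal_leI del: ennreal_plus)
    then show ?thesis unfolding a_def b_def .
  qed
  finally show ?thesis .
qed

text \<open>Integrating the pointwise bound in polar coordinates.\<close>
lemma weight_drift_far:
  assumes x: "12/5 < norm x"
  shows "(\<integral>\<^sup>+y. weight y \<partial>annulus_kernel x) \<le> ennreal (1999/2000) * weight x"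
proof -
  define r where "r = norm x"
  have x0: "x \<noteq> 0" using x by auto
  have r: "12/5 < r" using x by (simp add: r_def)
  define h where "h s = ennreal (exp (r / 16)) * (ennreal (radial_gain r s / (2 * pi * s)) * indicator {r-1..r+1} s)" for s
  have [measurable]: "radial_gain r \<in> borel_measurable borel"
    unfolding radial_gain_def[abs_def] by measurable
  have h[measurable]: "h \<in> borel_measurable borel" unfolding h_def[abs_def] by measurable
  have "(\<integral>\<^sup>+y. weight y \<partial>annulus_kernel x) \<le> (\<integral>\<^sup>+y. h (norm y) \<partial>(lborel :: (real^2) measure))"
    unfolding nn_integral_annulus_kernel[OF x0 weight_measurable]
  proof (intro nn_integral_mono)
    fix y
    show "ennreal (proposal_density x y) * annulus.after_proposal x weight y \<le> h (norm y)"
    proof (cases "y \<in> annulus x")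
      case True
      then have "norm y \<in> {r-1..r+1}" by (auto simp: annulus_def r_def)
      then show ?thesis using after_proposal_weight_far[OF x True]
        by (simp add: h_def r_def ennreal_mult'[symmetric])
    qed (simp add: proposal_density_def)
  qed
  also have "\<dots> = (\<integral>\<^sup>+s. ennreal (2 * pi * s) * h s \<partial>lborel)"
    by (rule nn_integral_radial[OF h])
  also have "\<dots> = (\<integral>\<^sup>+s. ennreal (exp (r / 16)) * (ennreal (radial_gain r s) * indicator {r-1..r+1} s) \<partial>lborel)"
  proof (intro nn_integral_cong)
    fix s
    have "ennreal (2 * pi * s) * ennreal (radial_gain r s / (2 * pi * s)) = ennreal (radial_gain r s)" if "s \<in> {r-1..r+1}"
      using that r by (subst ennreal_mult'[symmetric]) auto
    then have "ennreal (exp (r / 16)) * (ennreal (2 * pi * s) * ennreal (radial_gain r s / (2 * pi * s))) * indicator {r-1..r+1} s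
        = ennreal (exp (r / 16)) * ennreal (radial_gain r s) * indicator {r-1..r+1} s"
      by (cases "s \<in> {r-1..r+1}") (simp_all only: indicator_simps mult_zero_right not_False_eq_True)
    then show "ennreal (2 * pi * s) * h s = ennreal (exp (r / 16)) * (ennreal (radial_gain r s) * indicator {r-1..r+1} s)"
      unfolding h_def by (simp only: ac_simps)
  qed
  also have "\<dots> = ennreal (exp (r / 16)) * (\<integral>\<^sup>+s. ennreal (radial_gain r s) * indicator {r-1..r+1} s \<partial>lborel)"
    by (rule nn_integral_cmult) measurable
  also have "\<dots> \<le> ennreal (exp (r / 16)) * ennreal (1999/2000)"
    by (intro mult_left_mono radial_gain_total r) simp
  also have "\<dots> = ennreal (1999/2000) * weight x"
    using x0 r by (simp add: weight_def lyapunov_def r_def mult.commute)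
  finally show ?thesis .
qed

text \<open>At the origin, where the chain is stuck, the inequality holds because the weight is infinite.\<close>
lemma weight_drift:
  "(\<integral>\<^sup>+y. weight y \<partial>annulus_kernel x) \<le> ennreal (1999/2000) * weight x + ennreal (1/2) * indicator core x"
proof -
  consider "x = 0" | "x \<noteq> 0" "norm x < 1/2" | "x \<in> core" | "12/5 < norm x"
    by (cases "x = 0"; cases "norm x < 1/2"; cases "12/5 < norm x") (auto simp: core_def not_less)
  then show ?thesis
  proof cases
    case 1
    then show ?thesis by (simp add: weight_def ennreal_mult_top)
  next
    case 2
    have "ennreal (49/40) \<le> ennreal (1999/2000) * weight x"
      using 2 by (simp add: weight_def lyapunov_def ennreal_mult[symmetric])
    then show ?thesis
      using order_trans[OF weight_drift_small[OF 2]] by (auto intro: add_increasing2)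
  next
    case 3
    have "ennreal (13/10) \<le> ennreal (1999/2000) + ennreal (1/2)"
      by (subst ennreal_plus[symmetric]) auto
    also have "\<dots> \<le> ennreal (1999/2000) * weight x + ennreal (1/2)"
      using mult_left_mono[OF weight_ge_1[of x], of "ennreal (1999/2000)"] by (intro add_right_mono) simp
    finally have "ennreal (13/10) \<le> ennreal (1999/2000) * weight x + ennreal (1/2) * indicator core x"
      using 3 by simp
    then show ?thesis using weight_drift_core[OF 3] by (rule order_trans[rotated])
  next
    case 4
    then show ?thesis using weight_drift_far[OF 4] by (auto intro: add_increasing2)
  qed
qed


section \<open>Minorization on the core\<close>

text \<open>On the core \<open>H \<ge> 2\<close>, and on the common annulus \<open>H \<le> 9/4\<close>, so a proposal \<open>y\<close> in that annulus is
  accepted with probability at least \<open>min 1 (3 r\<^sub>x / (4 r\<^sub>y))\<close>. Multiplied by the proposal density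
  \<open>1 / (4 \<pi> r\<^sub>x)\<close> this is at least \<open>1 / (10 \<pi>)\<close> in either case.\<close>
lemma minorant_le_kernel:
  assumes x: "x \<in> core" and A[measurable]: "A \<in> sets borel"
  shows "emeasure minorant A \<le> emeasure (annulus_kernel x) A"
proof -
  have x0: "x \<noteq> 0" using x by (auto simp: core_def)
  have "emeasure minorant A = (\<integral>\<^sup>+y. ennreal (1 / (10 * pi)) * indicator common_annulus y * indicator A y \<partial>lborel)"
    unfolding minorant_def by (subst emeasure_density) auto
  also have "\<dots> \<le> (\<integral>\<^sup>+y. ennreal (proposal_density x y) * annulus.after_proposal x (indicator A) y \<partial>lborel)"
  proof (intro nn_integral_mono)
    fix y
    show "ennreal (1 / (10 * pi)) * indicator common_annulus y * indicator A y
      \<le> ennreal (proposal_density x y) * annulus.after_proposal x (indicator A) y"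
    proof (cases "y \<in> common_annulus \<inter> A")
      case True
      define r s where "r = norm x" and "s = norm y"
      have r: "1/2 \<le> r" "r \<le> 12/5" using x by (auto simp: core_def r_def)
      have s: "7/5 < s" "s < 3/2" using True by (auto simp: common_annulus_def s_def)
      have y: "y \<in> annulus x" using r s by (auto simp: annulus_def r_def s_def)
      define \<alpha> where "\<alpha> = mh_accept target_density proposal_density x y"
      have \<alpha>: "0 \<le> \<alpha>" "\<alpha> \<le> 1" using annulus.accept_01[of x y] by (simp_all add: \<alpha>_def)
      have "2 \<le> r + 1/r"
      proof -
        have "0 \<le> (r - 1)\<^sup>2 / r" using r by simp
        also have "\<dots> = r + 1/r - 2" using r by (simp add: field_simps power2_eq_square)
        finally show ?thesis by simp
      qed
      moreover have "s + 1/s \<le> 9/4"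
      proof -
        have "1 / s \<le> 5/7" using s by (simp add: field_simps)
        then show ?thesis using s by simp
      qed
      ultimately have "3/4 \<le> 1 + ((r + 1/r) - (s + 1/s))" by simp
      also have "\<dots> \<le> exp ((r + 1/r) - (s + 1/s))" by (rule exp_ge_add_one_self)
      finally have e: "r / s * (3/4) \<le> r / s * exp ((r + 1/r) - (s + 1/s))"
        using r s by (intro mult_left_mono) auto
      have "1 / (10 * pi) \<le> 1 / (4 * pi * r) * min 1 (r / s * (3/4))"
        using r s by (auto simp: min_def field_simps)
      also have "\<dots> \<le> 1 / (4 * pi * r) * \<alpha>"
        unfolding \<alpha>_def accept_annulus[OF x0 y] using e r
        by (intro mult_left_mono min.mono) (auto simp: r_def s_def)
      also have "\<dots> = proposal_density x y * \<alpha>" using y by (simp add: proposal_density_def r_def)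
      finally have "ennreal (1 / (10 * pi)) \<le> ennreal (proposal_density x y * \<alpha>)"
        by (rule ennreal_leI)
      also have "\<dots> = ennreal (proposal_density x y) * ennreal \<alpha>"
        using \<alpha> by (intro ennreal_mult annulus.q_nonneg)
      also have "\<dots> \<le> ennreal (proposal_density x y) * annulus.after_proposal x (indicator A) y"
        using True by (intro mult_left_mono) (auto simp: annulus.after_proposal_def \<alpha>_def)
      finally show ?thesis using True by simp
    qed (auto simp: indicator_def)
  qed
  also have "\<dots> = (\<integral>\<^sup>+z. indicator A z \<partial>annulus_kernel x)"
    by (rule nn_integral_annulus_kernel[OF x0, symmetric]) measurable
  also have "\<dots> = emeasure (annulus_kernel x) A"
    by (simp add: annulus_kernel_def annulus.sets_mh_kernel)
  finally show ?thesis .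
qed

lemma minorant_mass: "emeasure minorant UNIV = ennreal (29/1000)"
proof -
  have "common_annulus = ball 0 (3/2) - cball 0 (7/5)" by (auto simp: common_annulus_def)
  moreover have "emeasure lborel (ball 0 (3/2) - cball 0 (7/5) :: (real^2) set) = ennreal (29/100 * pi)"
    by (subst emeasure_Diff) (auto simp: emeasure_ball emeasure_cball unit_ball_vol_2 ennreal_minus power2_eq_square algebra_simps)
  ultimately have "emeasure lborel common_annulus = ennreal (29/100 * pi)" by simp
  moreover have "emeasure minorant UNIV = ennreal (1 / (10 * pi)) * emeasure lborel common_annulus"
    unfolding minorant_def by (subst emeasure_density) (auto simp: nn_integral_cmult_indicator)
  ultimately show ?thesis by (simp add: ennreal_mult[symmetric])
qed

interpretation annulus_drift: drift_minorization borel annulus_kernel core minorant weight "1999/2000" "1/2" "29/1000"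
proof (rule drift_minorization.intro)
  show "annulus_kernel \<in> borel \<rightarrow>\<^sub>M prob_algebra borel" by (rule annulus_kernel_measurable)
  show "sets minorant = sets borel" by (simp add: minorant_def)
  show "finite_measure minorant"
    using minorant_mass by (intro finite_measureI) (simp add: minorant_def)
  show "ennreal (29/1000) \<le> emeasure minorant (space borel)" by (simp add: minorant_mass)
qed (use minorant_le_kernel weight_ge_1 weight_drift in auto)


section \<open>The target measure\<close>

text \<open>In polar coordinates the integrand is dominated by a multiple of the Erlang density
  proportional to \<open>s exp (-s/2)\<close>. As the weight is at least \<open>1\<close>, this also makes the target density
  integrable.\<close>
lemma nn_integral_times_target_finite:
  "(\<integral>\<^sup>+x. weight x * ennreal (target_density x) \<partial>lborel) < \<infinity>"
proof -
  define h where "h s = ennreal (5/4 * exp (- (s / 2)))" for s :: real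
  have [measurable]: "h \<in> borel_measurable borel" unfolding h_def[abs_def] by measurable
  have le: "weight x * ennreal (target_density x) \<le> h (norm x)" for x
  proof (cases "x = 0")
    case False
    have "lyapunov r * exp (- (r + 1 / r)) \<le> 5/4 * exp (- (r / 2))" if "r > 0" for r
    proof -
      have "lyapunov r \<le> 5/4 * exp (r / 16)"
        using that by (simp add: lyapunov_def)
      then have "lyapunov r * exp (- (r + 1 / r)) \<le> 5/4 * exp (r / 16) * exp (- (r + 1 / r))"
        by (rule mult_right_mono) simp
      also have "\<dots> = 5/4 * exp (r / 16 - (r + 1 / r))" by (simp add: exp_add[symmetric])
      also have "\<dots> \<le> 5/4 * exp (- (r / 2))"
      proof -
        have "0 \<le> 1 / r" using that by simp
        then have "r / 16 - (r + 1 / r) \<le> - (r / 2)" using that by linarith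
        then show ?thesis by simp
      qed
      finally show ?thesis .
    qed
    from this[of "norm x"] show ?thesis using False lyapunov_ge_1[of "norm x"]
      by (simp add: h_def weight_def target_density_def ennreal_mult[symmetric] ennreal_leI)
  qed (simp add: target_density_def)
  have "(\<integral>\<^sup>+x. weight x * ennreal (target_density x) \<partial>lborel) \<le> (\<integral>\<^sup>+x. h (norm x) \<partial>(lborel :: (real^2) measure))"
    by (intro nn_integral_mono le)
  also have "\<dots> = (\<integral>\<^sup>+s. ennreal (2 * pi * s) * h s \<partial>lborel)"
    by (rule nn_integral_radial) measurable
  also have "\<dots> = (\<integral>\<^sup>+s. ennreal (10 * pi) * ennreal (erlang_density 1 (1/2) s) \<partial>lborel)"
  proof (intro nn_integral_cong)
    fix s :: real
    show "ennreal (2 * pi * s) * h s = ennreal (10 * pi) * ennreal (erlang_density 1 (1/2) s)"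
    proof (cases "s < 0")
      case True
      then show ?thesis by (simp add: erlang_density_def ennreal_neg mult_nonneg_nonpos)
    next
      case False
      then show ?thesis
        by (simp add: h_def erlang_density_def ennreal_mult[symmetric] power2_eq_square)
    qed
  qed
  also have "\<dots> = ennreal (10 * pi) * emeasure (density lborel (erlang_density 1 (1/2))) UNIV"
    by (simp add: nn_integral_cmult emeasure_density)
  also have "\<dots> < \<infinity>"
    using prob_space.emeasure_space_1[OF prob_space_erlang_density[of "1/2" 1]] by simp
  finally show ?thesis .
qed

lemma target_mass:
  defines "Z \<equiv> \<integral>z. target_density z \<partial>lborel"
  shows "0 < Z" "(\<integral>\<^sup>+x. ennreal (target_density x) \<partial>lborel) = ennreal Z"
proof -
  have "(\<integral>\<^sup>+x. ennreal (target_density x) \<partial>lborel) \<le> (\<integral>\<^sup>+x. weight x * ennreal (target_density x) \<partial>lborel)"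
    using weight_ge_1 by (intro nn_integral_mono) (metis mult_1 mult_right_mono zero_le)
  then have fin: "(\<integral>\<^sup>+x. ennreal (target_density x) \<partial>lborel) < \<infinity>"
    using nn_integral_times_target_finite by (rule le_less_trans)
  have int: "integrable lborel target_density"
    using fin by (intro integrableI_nonneg) (auto simp: target_density_nonneg)
  show eq: "(\<integral>\<^sup>+x. ennreal (target_density x) \<partial>lborel) = ennreal Z"
    unfolding Z_def by (intro nn_integral_eq_integral int) (simp add: target_density_nonneg)
  have "(\<integral>\<^sup>+x. ennreal (target_density x) \<partial>lborel) \<noteq> 0"
  proof
    assume "(\<integral>\<^sup>+x. ennreal (target_density x) \<partial>lborel) = 0"
    then have "AE x in lborel. ennreal (target_density x) = 0"
      by (subst (asm) nn_integral_0_iff_AE) auto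
    with AE_lborel_singleton[of 0] have "AE x in (lborel :: (real^2) measure). False"
    proof eventually_elim
      case (elim x)
      then show False using target_density_pos[of x] by (simp add: ennreal_eq_0_iff)
    qed
    then show False by (simp add: AE_iff_measurable[OF _ refl])
  qed
  then show "0 < Z" by (simp add: eq ennreal_eq_0_iff)
qed

lemma nn_integral_target_measure:
  assumes [measurable]: "f \<in> borel_measurable borel"
  shows "(\<integral>\<^sup>+x. f x \<partial>target_measure)
    = ennreal (1 / (\<integral>z. target_density z \<partial>lborel)) * (\<integral>\<^sup>+x. ennreal (target_density x) * f x \<partial>lborel)"
proof -
  have "(\<integral>\<^sup>+x. f x \<partial>target_measure)
      = (\<integral>\<^sup>+x. ennreal (target_density x / (\<integral>z. target_density z \<partial>lborel)) * f x \<partial>lborel)"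
    unfolding target_measure_def by (rule nn_integral_density) measurable
  also have "\<dots> = (\<integral>\<^sup>+x. ennreal (1 / (\<integral>z. target_density z \<partial>lborel)) * (ennreal (target_density x) * f x) \<partial>lborel)"
    using target_mass(1)
    by (intro nn_integral_cong)
      (simp add: mult.assoc[symmetric] ennreal_mult[symmetric] target_density_nonneg)
  also have "\<dots> = ennreal (1 / (\<integral>z. target_density z \<partial>lborel)) * (\<integral>\<^sup>+x. ennreal (target_density x) * f x \<partial>lborel)"
    by (rule nn_integral_cmult) measurable
  finally show ?thesis .
qed

lemma sets_target_measure[measurable_cong]: "sets target_measure = sets borel"
  by (simp add: target_measure_def)

lemma prob_space_target_measure: "prob_space target_measure"
proof
  have "emeasure target_measure (space target_measure) = (\<integral>\<^sup>+x. 1 \<partial>target_measure)" by simp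
  also have "\<dots> = 1"
    using target_mass by (subst nn_integral_target_measure) (auto simp: ennreal_mult[symmetric])
  finally show "emeasure target_measure (space target_measure) = 1" .
qed

lemma target_measure_invariant: "target_measure \<bind> annulus_kernel = target_measure"
proof (rule measure_eqI)
  have K: "annulus_kernel \<in> target_measure \<rightarrow>\<^sub>M subprob_algebra borel"
    using measurable_prob_algebraD[OF annulus_kernel_measurable] by measurable
  have sp: "space target_measure = UNIV" by (simp add: target_measure_def)
  show s: "sets (target_measure \<bind> annulus_kernel) = sets target_measure"
    using measurable_space[OF K] by (subst sets_bind[where N = borel]) (auto simp: sp sets_target_measure space_subprob_algebra)
  fix A assume "A \<in> sets (target_measure \<bind> annulus_kernel)"
  then have A[measurable]: "A \<in> sets borel" using s by (simp add: sets_target_measure)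
  have [measurable]: "(\<lambda>x. emeasure (annulus_kernel x) A) \<in> borel_measurable borel"
    using measurable_compose[OF measurable_prob_algebraD[OF annulus_kernel_measurable] measurable_emeasure_subprob_algebra[OF A]] .
  have "emeasure (target_measure \<bind> annulus_kernel) A = (\<integral>\<^sup>+x. emeasure (annulus_kernel x) A \<partial>target_measure)"
    by (rule emeasure_bind[OF _ K A]) (simp add: sp)
  also have "\<dots> = ennreal (1 / (\<integral>z. target_density z \<partial>lborel)) *
      (\<integral>\<^sup>+x. ennreal (target_density x) * emeasure (annulus_kernel x) A \<partial>lborel)"
    by (rule nn_integral_target_measure) measurable
  also have "(\<integral>\<^sup>+x. ennreal (target_density x) * emeasure (annulus_kernel x) A \<partial>lborel)
      = (\<integral>\<^sup>+x. ennreal (target_density x) * (\<integral>\<^sup>+z. indicator A z \<partial>mh_kernel target_density proposal_density x) \<partial>lborel)"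
    by (intro nn_integral_cong) (simp add: annulus_kernel_def target_density_def annulus.sets_mh_kernel)
  also have "\<dots> = (\<integral>\<^sup>+x. ennreal (target_density x) * indicator A x \<partial>lborel)"
    by (rule annulus.invariant) measurable
  also have "ennreal (1 / (\<integral>z. target_density z \<partial>lborel)) * \<dots> = (\<integral>\<^sup>+x. indicator A x \<partial>target_measure)"
    by (rule nn_integral_target_measure[symmetric]) measurable
  also have "\<dots> = emeasure target_measure A" by (simp add: sets_target_measure)
  finally show "emeasure (target_measure \<bind> annulus_kernel) A = emeasure target_measure A" .
qed


section \<open>The law of the chain\<close>

text \<open>Taking expectations in the Markov property; a conditional expectation has the same mean as the
  original variable.\<close>
lemma markov_chain_law:
  assumes chain: "markov_chain M N K x0 X" and K: "K \<in> N \<rightarrow>\<^sub>M prob_algebra N"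
  shows "distr M N (X (Suc k)) = distr M N (X k) \<bind> K"
proof (rule measure_eqI)
  interpret prob_space M using chain by (simp add: markov_chain_def)
  have X[measurable]: "X k \<in> M \<rightarrow>\<^sub>M N" for k using chain by (simp add: markov_chain_def)
  note K'[measurable] = measurable_prob_algebraD[OF K]
  have K_distr: "K \<in> distr M N (X k) \<rightarrow>\<^sub>M subprob_algebra N" by measurable
  have ne: "space N \<noteq> {}" using measurable_space[OF X] not_empty by blast
  have K_space: "prob_space (K x)" "sets (K x) = sets N" if "x \<in> space N" for x
    using measurable_space[OF K that] by (auto simp: space_prob_algebra)
  show s: "sets (distr M N (X (Suc k))) = sets (distr M N (X k) \<bind> K)"
    using K_space ne by (subst sets_bind[where N = N]) auto
  fix A assume "A \<in> sets (distr M N (X (Suc k)))"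
  then have A[measurable]: "A \<in> sets N" by simp
  have [measurable]: "(\<lambda>x. measure (K x) A) \<in> borel_measurable N"
    using measurable_compose[OF K' measurable_measure_subprob_algebra[OF A]] .
  have sub: "subalgebra M (history M N X k)"
  proof -
    have "{X i -` A \<inter> space M |i A. i \<le> k \<and> A \<in> sets N} \<subseteq> sets M"
      using X by (auto intro: measurable_sets)
    then have "sigma_sets (space M) {X i -` A \<inter> space M |i A. i \<le> k \<and> A \<in> sets N} \<subseteq> sets M"
      by (rule sets.sigma_sets_subset)
    moreover have "{X i -` A \<inter> space M |i A. i \<le> k \<and> A \<in> sets N} \<subseteq> Pow (space M)" by auto
    ultimately show ?thesis
      by (simp add: subalgebra_def history_def sets_measure_of space_measure_of)
  qed
  interpret F: finite_measure_subalgebra M "history M N X k"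
    by unfold_locales (rule sub)
  let ?f = "\<lambda>\<omega>. indicator A (X (Suc k) \<omega>) :: real"
  have int: "integrable M ?f"
    by (rule integrable_const_bound[where B = 1]) auto
  have K_le: "measure (K (X k \<omega>)) A \<le> 1" if "\<omega> \<in> space M" for \<omega>
    using K_space(1)[OF measurable_space[OF X that]] by (rule prob_space.prob_le_1)
  have ce: "AE \<omega> in M. real_cond_exp M (history M N X k) ?f \<omega> = measure (K (X k \<omega>)) A"
    using chain A unfolding markov_chain_def by blast
  have "emeasure (distr M N (X (Suc k))) A = (\<integral>\<^sup>+x. indicator A x \<partial>distr M N (X (Suc k)))"
    by simp
  also have "\<dots> = (\<integral>\<^sup>+\<omega>. indicator A (X (Suc k) \<omega>) \<partial>M)"
    by (rule nn_integral_distr) measurable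
  also have "\<dots> = (\<integral>\<^sup>+\<omega>. ennreal (?f \<omega>) \<partial>M)"
    by (simp add: ennreal_indicator)
  also have "\<dots> = ennreal (\<integral>\<omega>. ?f \<omega> \<partial>M)"
    by (rule nn_integral_eq_integral[OF int]) simp
  also have "(\<integral>\<omega>. ?f \<omega> \<partial>M) = (\<integral>\<omega>. real_cond_exp M (history M N X k) ?f \<omega> \<partial>M)"
    by (rule F.real_cond_exp_int(2)[OF int, symmetric])
  also have "\<dots> = (\<integral>\<omega>. measure (K (X k \<omega>)) A \<partial>M)"
    using ce by (intro integral_cong_AE) measurable
  also have "ennreal \<dots> = (\<integral>\<^sup>+\<omega>. ennreal (measure (K (X k \<omega>)) A) \<partial>M)"
    using K_le by (intro nn_integral_eq_integral[symmetric] integrable_const_bound[where B = 1]) auto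
  also have "\<dots> = (\<integral>\<^sup>+\<omega>. emeasure (K (X k \<omega>)) A \<partial>M)"
    using K_space(1) measurable_space[OF X]
    by (intro nn_integral_cong) (simp add: finite_measure.emeasure_eq_measure prob_space_def)
  also have "\<dots> = (\<integral>\<^sup>+x. emeasure (K x) A \<partial>distr M N (X k))"
    by (subst nn_integral_distr) auto
  also have "\<dots> = emeasure (distr M N (X k) \<bind> K) A"
    by (rule emeasure_bind[OF _ K_distr A, symmetric]) (simp add: ne)
  finally show "emeasure (distr M N (X (Suc k))) A = emeasure (distr M N (X k) \<bind> K) A" .
qed

theorem mainTheorem4:
  fixes M :: "'w measure" and X :: "nat \<Rightarrow> 'w \<Rightarrow> real^2" and n :: nat
  assumes "markov_chain M borel annulus_kernel (vector [1, 0]) X"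
    and "n \<ge> 1"
  shows "tv_dist borel
           (\<lambda>S. (\<Sum>k=1..n. \<P>(\<omega> in M. X k \<omega> \<in> S)) / real n)
           (measure target_measure)
         \<le> 39900000 / real n"
proof -
  interpret prob_space M using assms(1) by (simp add: markov_chain_def)
  have X[measurable]: "X k \<in> M \<rightarrow>\<^sub>M borel" for k using assms(1) by (simp add: markov_chain_def)
  define \<mu> where "\<mu> k = distr M borel (X k)" for k
  have \<mu>: "sets (\<mu> k) = sets borel" "prob_space (\<mu> k)" "\<mu> (Suc k) = \<mu> k \<bind> annulus_kernel" for k
    using markov_chain_law[OF assms(1) annulus_kernel_measurable] by (simp_all add: \<mu>_def prob_space_distr)
  have norm_x0: "norm (vector [1, 0] :: real^2) = 1"
    by (simp add: norm_vec_def L2_set_def sum_2)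
  have "(\<integral>\<^sup>+x. weight x \<partial>\<mu> 0) = (\<integral>\<^sup>+\<omega>. weight (X 0 \<omega>) \<partial>M)"
    unfolding \<mu>_def by (rule nn_integral_distr) measurable
  also have "\<dots> = (\<integral>\<^sup>+\<omega>. weight (vector [1, 0]) \<partial>M)"
  proof (rule nn_integral_cong_AE)
    have "AE \<omega> in M. X 0 \<omega> = vector [1, 0]" using assms(1) by (simp add: markov_chain_def)
    then show "AE \<omega> in M. weight (X 0 \<omega>) = weight (vector [1, 0])" by eventually_elim simp
  qed
  also have "\<dots> = weight (vector [1, 0])" by (simp add: emeasure_space_1)
  also have "\<dots> \<le> ennreal 2"
  proof -
    have "exp (1/16) \<le> (2 :: real)" using exp_bound[of "1/16"] by (simp add: power2_eq_square)
    moreover have "vector [1, 0] \<noteq> (0 :: real^2)" using norm_x0 by (metis norm_zero zero_neq_one)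
    ultimately show ?thesis by (simp add: weight_def lyapunov_def norm_x0 ennreal_leI del: ennreal_numeral)
  qed
  finally have start: "(\<integral>\<^sup>+x. weight x \<partial>\<mu> 0) \<le> ennreal 2" .
  have \<pi>: "(\<integral>\<^sup>+x. weight x \<partial>target_measure) < \<infinity>"
    using nn_integral_times_target_finite
    by (simp add: nn_integral_target_measure mult.commute[of "ennreal (target_density _)"] ennreal_mult_less_top)
  have main: "\<bar>(\<Sum>k=1..n. measure (\<mu> k) S) - real n * measure target_measure S\<bar> \<le> 39900000" if "S \<in> sets borel" for S
    using annulus_drift.averages_bound[OF \<mu> _ start sets_target_measure prob_space_target_measure
        target_measure_invariant \<pi> that, of n] by simp
  show ?thesis
    unfolding tv_dist_def
  proof (rule cSUP_least)
    fix S :: "(real^2) set" assume S[measurable]: "S \<in> sets borel"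
    have P: "\<P>(\<omega> in M. X k \<omega> \<in> S) = measure (\<mu> k) S" for k
      by (simp add: \<mu>_def measure_distr vimage_def Int_def conj_commute)
    have "(\<Sum>k=1..n. \<P>(\<omega> in M. X k \<omega> \<in> S)) / real n - measure target_measure S
        = ((\<Sum>k=1..n. measure (\<mu> k) S) - real n * measure target_measure S) / real n"
      using assms(2) by (simp add: P diff_divide_distrib)
    then show "\<bar>(\<Sum>k=1..n. \<P>(\<omega> in M. X k \<omega> \<in> S)) / real n - measure target_measure S\<bar> \<le> 39900000 / real n"
      using main[OF S] by (simp add: abs_divide divide_right_mono)
  qed auto
qed

end
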